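(* There is an absolute constant $c>0$ such that the following holds. Let $p_1,p_2,p_3$ be three noncollinear points in the plane, and let $P$ be a set of $n$ points in the plane, distinct from $p_1,p_2,p_3$. Then the number of distinct distances in the set $\{|p_iq| : i\in\{1,2,3\},\ q\in P\}$ is at least $c\,n^{6/11}$; that is, it is $\Omega(n^{6/11})$.
   Context: $|pq|$ denotes the Euclidean distance between points $p,q\in\mathbb{R}^2$. *)

theory Defs
  imports "HOL-Analysis.Analysis"
begin

end

theory Submission
  imports Defs
begin

text \<open>
  Normalise so that the three points are \<open>0\<close>, \<open>1\<close> and \<open>b\<close> in the complex plane, and write \<open>X\<close>, \<open>Z\<close>,
  \<open>Y\<close> for the squared distances of a point \<open>q\<close> from them. If each takes at most \<open>m\<close> values on a
  set of \<open>n\<close> points, then by Cauchy-Schwarz at least \<open>n\<^sup>2 / m\<close> pairs \<open>(q, q')\<close> have equal \<open>Z\<close>. Such a pair is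
  an incidence between the point \<open>(X q, X q')\<close> of an \<open>m \<times> m\<close> grid and the curve indexed by
  \<open>(Y q, Y q')\<close>. After restriction to a sector cut out by the three lines through the given points, each
  curve is a monotone chain, so it meets only \<open>O(r)\<close> cells of an \<open>r \<times> r\<close> subdivision of the
  grid, and two grid points off the diagonal lie on boundedly many common curves. Counting in each cell with
  \<open>r\<close> about \<open>m\<^bsup>2/3\<^esup>\<close> bounds the incidences by \<open>O(m\<^bsup>8/3\<^esup>)\<close>, whence \<open>n\<^sup>2 = O(m\<^bsup>11/3\<^esup>)\<close>.

  The bounded multiplicity is algebraic. For two grid points, the values \<open>Y\<close> admitting a common
  curve are roots of a polynomial of bounded degree. It does not vanish identically, because the asymptotic
  expansion at infinity of \<open>Y'\<close> as a function of \<open>Y\<close> determines \<open>X\<close> and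
  \<open>X'\<close>, provided the angle at \<open>0\<close> is not right. At most one of the three angles is right, so this
  can be arranged.
\<close>

section \<open>Incidences between a grid and monotone chains\<close>

text \<open>Along a chain both cell indices increase weakly, so their sum determines the cell and
  one curve meets fewer than \<open>2*r\<close> cells. Fix a representative incidence for each curve
  and each cell it meets. Any other incidence forms, with its representative, a pair of distinct
  points of one cell on a common curve; at most \<open>r^2 * k^4\<close> ordered pairs share a cell,
  and distinct points share at most \<open>K\<close> curves.\<close>

lemma grid_incidence_bound:
  fixes I :: "((nat \<times> nat) \<times> 'g) set"
  assumes sub: "I \<subseteq> ({..<m} \<times> {..<m}) \<times> L" and fin: "finite L" and k: "k > 0"
    and chain: "\<And>g x x' y y'. ((x,x'),g) \<in> I \<Longrightarrow> ((y,y'),g) \<in> I \<Longrightarrow> x < y \<Longrightarrow> x' \<le> y'"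
    and two: "\<And>p q. p \<noteq> q \<Longrightarrow> card {g. (p,g) \<in> I \<and> (q,g) \<in> I} \<le> K"
  defines "r \<equiv> m div k + 1"
  shows "card I \<le> 2 * r * card L + K * (r^2 * k^4)"
proof -
  define c where "c = (\<lambda>(x::nat,x'::nat). (x div k, x' div k))"
  define J where "J = (\<lambda>(p,g). (c p, g)) ` I"
  have finI: "finite I"
    using sub fin finite_subset by blast
  have divr: "x div k < r" if "x < m" for x
    using that k by (simp add: r_def less_Suc_eq_le div_le_mono)
  have "card J \<le> card ({..<2*r} \<times> L)"
  proof (rule card_inj_on_le[where f = "\<lambda>((i,j),g). (i+j,g)"])
    show "inj_on (\<lambda>((i,j),g). (i+j,g)) J"
    proof (rule inj_onI)
      fix u v assume u: "u \<in> J" and v: "v \<in> J"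
        and eq: "(case u of (x, xa) \<Rightarrow> (case x of (i, j) \<Rightarrow> \<lambda>g. (i + j, g)) xa) =
          (case v of (x, xa) \<Rightarrow> (case x of (i, j) \<Rightarrow> \<lambda>g. (i + j, g)) xa)"
      obtain x x' g where xu: "((x,x'),g) \<in> I" "u = ((x div k, x' div k), g)"
        using u by (auto simp: J_def c_def)
      obtain y y' h where yv: "((y,y'),h) \<in> I" "v = ((y div k, y' div k), h)"
        using v by (auto simp: J_def c_def)
      have gh: "g = h" and s: "x div k + x' div k = y div k + y' div k"
        using eq xu yv by auto
      have "x div k = y div k"
      proof (cases x y rule: linorder_cases)
        case less
        then have "x div k \<le> y div k" "x' div k \<le> y' div k"
          using chain xu yv gh by (auto intro: div_le_mono)
        then show ?thesis using s by linarith
      next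
        case greater
        then have "y div k \<le> x div k" "y' div k \<le> x' div k"
          using chain xu yv gh by (auto intro: div_le_mono)
        then show ?thesis using s by linarith
      qed simp
      then show "u = v" using s xu yv gh by auto
    qed
    show "(\<lambda>((i,j),g). (i+j,g)) ` J \<subseteq> {..<2*r} \<times> L"
    proof clarify
      fix i j g assume "((i,j),g) \<in> J"
      then obtain x x' where x: "((x,x'),g) \<in> I" "i = x div k" "j = x' div k"
        by (auto simp: J_def c_def)
      have "x < m" "x' < m" "g \<in> L" using x sub by auto
      then show "i + j \<in> {..<2*r} \<and> g \<in> L" using divr[of x] divr[of x'] x by auto
    qed
  qed (use fin in auto)
  then have cJ: "card J \<le> 2 * r * card L"
    by (simp add: card_cartesian_product)

  \<comment> \<open>\<open>f\<close> chooses the representatives, \<open>R\<close> collects their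
    incidences, and \<open>T\<close> contains the pairs to which the remaining incidences are
    charged.\<close>
  define f where "f = (\<lambda>w. SOME p. (p, snd w) \<in> I \<and> c p = fst w)"
  have f: "(f (c p, g), g) \<in> I \<and> c (f (c p, g)) = c p" if "(p,g) \<in> I" for p g
    unfolding f_def using someI[of "\<lambda>q. (q,g) \<in> I \<and> c q = c p" p] that by auto
  define R where "R = {(p,g) \<in> I. f (c p, g) = p}"
  define T where "T = {((p,q),g). p \<noteq> q \<and> c p = c q \<and> (p,g) \<in> I \<and> (q,g) \<in> I}"
  have "R \<subseteq> (\<lambda>w. (f w, snd w)) ` J"
  proof
    fix w assume w: "w \<in> R"
    then have "w = (\<lambda>w. (f w, snd w)) (c (fst w), snd w)" "(c (fst w), snd w) \<in> J"
      by (auto simp: R_def J_def intro!: rev_image_eqI)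
    then show "w \<in> (\<lambda>w. (f w, snd w)) ` J" by blast
  qed
  then have cR: "card R \<le> card J"
    using finI by (intro surj_card_le) (simp_all add: J_def)
  define S where "S = {(p,q). p \<in> {..<m} \<times> {..<m} \<and> q \<in> {..<m} \<times> {..<m} \<and> c p = c q}"
  \<comment> \<open>A pair within one cell is recovered from that cell and the offsets of both
    points modulo \<open>k\<close>.\<close>
  have "card S \<le> card (({..<r} \<times> {..<r}) \<times> ({..<k} \<times> {..<k}) \<times> ({..<k} \<times> {..<k}))"
  proof (rule card_inj_on_le[where f = "\<lambda>((x,x'),(y,y')).
      ((x div k, x' div k), (x mod k, x' mod k), (y mod k, y' mod k))"])
    show "inj_on (\<lambda>((x,x'),(y,y')).
      ((x div k, x' div k), (x mod k, x' mod k), (y mod k, y' mod k))) S"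
      by (auto simp: inj_on_def S_def c_def) (metis div_mult_mod_eq)+
  qed (use divr k in \<open>auto simp: S_def\<close>)
  then have cS: "card S \<le> r^2 * k^4"
    by (simp add: card_cartesian_product power2_eq_square power4_eq_xxxx mult.assoc)
  have finS: "finite S"
    by (rule finite_subset[of _ "({..<m} \<times> {..<m}) \<times> ({..<m} \<times> {..<m})"]) (auto simp: S_def)
  have Tsub: "T \<subseteq> (SIGMA w:{w\<in>S. fst w \<noteq> snd w}. {g. (fst w,g) \<in> I \<and> (snd w,g) \<in> I})"
    using sub by (auto simp: T_def S_def)
  have fing: "finite {g. (p,g) \<in> I \<and> (q,g) \<in> I}" for p q
    by (rule finite_subset[of _ L]) (use sub fin in auto)
  have finSig: "finite (SIGMA w:{w\<in>S. fst w \<noteq> snd w}. {g. (fst w,g) \<in> I \<and> (snd w,g) \<in> I})"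
    using finS fing by (intro finite_SigmaI) auto
  have "card T \<le> (\<Sum>w\<in>{w\<in>S. fst w \<noteq> snd w}. card {g. (fst w,g) \<in> I \<and> (snd w,g) \<in> I})"
    using card_mono[OF finSig Tsub] finS fing by (subst (asm) card_SigmaI) auto
  also have "\<dots> \<le> (\<Sum>w\<in>{w\<in>S. fst w \<noteq> snd w}. K)"
    by (intro sum_mono two) auto
  also have "\<dots> \<le> K * card S"
    using finS by (simp add: card_mono)
  also have "\<dots> \<le> K * (r^2 * k^4)" using cS by simp
  finally have cT: "card T \<le> K * (r^2 * k^4)" .
  have "card (I - R) \<le> card T"
  proof (rule card_inj_on_le[where f = "\<lambda>(p,g). ((p, f (c p, g)), g)"])
    show "inj_on (\<lambda>(p,g). ((p, f (c p, g)), g)) (I - R)" by (auto simp: inj_on_def)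
    show "(\<lambda>(p,g). ((p, f (c p, g)), g)) ` (I - R) \<subseteq> T"
      using f by (fastforce simp: R_def T_def)
    show "finite T" using finSig Tsub finite_subset by blast
  qed
  moreover have "card I = card R + card (I - R)"
  proof -
    have "R \<subseteq> I" by (auto simp: R_def)
    then show ?thesis using finI
      by (metis card_Diff_subset card_mono finite_subset le_add_diff_inverse)
  qed
  ultimately show ?thesis using cJ cR cT by linarith
qed

section \<open>Curves and their behaviour at infinity\<close>

text \<open>
  The complexified locus of pairs \<open>(q, q')\<close> with given \<open>\<bar>q\<bar>\<^sup>2 = X\<close>, \<open>\<bar>q'\<bar>\<^sup>2 = X'\<close> and
  \<open>\<bar>q - 1\<bar> = \<bar>q' - 1\<bar>\<close>, projected to the squared distances from \<open>b\<close>: the conjugates of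
  \<open>q\<close> and \<open>q'\<close> become the independent variables \<open>t\<close> and \<open>t'\<close>.
\<close>
definition curve :: "complex \<Rightarrow> real \<Rightarrow> real \<Rightarrow> complex \<Rightarrow> complex \<Rightarrow> bool" where
  "curve b X X' y y' \<longleftrightarrow> (\<exists>s t s' t'. s * t = of_real X \<and> s' * t' = of_real X' \<and>
     y = (s - b) * (t - cnj b) \<and> y' = (s' - b) * (t' - cnj b) \<and>
     (s - 1) * (t - 1) = (s' - 1) * (t' - 1))"

text \<open>
  Near infinity one of the factors in \<open>s * t = X\<close> dominates; it is the parameter \<open>a\<close> here, and
  \<open>X / a\<close> is the other one (also when \<open>a = 0\<close>, which forces \<open>X = 0\<close>). The slope \<open>l\<close>
  records which factor it is: \<open>cnj b\<close> for \<open>s\<close> and \<open>b\<close> for \<open>t\<close>.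
\<close>
definition branch :: "complex \<Rightarrow> complex \<Rightarrow> real \<Rightarrow> real \<Rightarrow> real \<Rightarrow> complex \<Rightarrow> complex \<Rightarrow> complex \<Rightarrow> complex \<Rightarrow> bool" where
  "branch l l' \<rho> X X' y y' a a' \<longleftrightarrow> \<bar>X\<bar> \<le> (norm a)\<^sup>2 \<and> \<bar>X'\<bar> \<le> (norm a')\<^sup>2 \<and>
     y = X + \<rho> - l * a - cnj l * (X / a) \<and> y' = X' + \<rho> - l' * a' - cnj l' * (X' / a') \<and>
     X - a - X / a = X' - a' - X' / a'"

text \<open>Take for \<open>a\<close> the factor of larger modulus. Since the moduli multiply to
  that of \<open>X\<close>, the square of the larger one dominates. If \<open>a = 0\<close> then
  both factors vanish, which agrees with division by zero giving zero.\<close>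

lemma dominant_factor:
  fixes s t b :: complex
  assumes "s * t = of_real X"
  obtains l and a :: complex where "l \<in> {b, cnj b}" "\<bar>X\<bar> \<le> (norm a)\<^sup>2" "a + X / a = s + t"
    "l * a + cnj l * (X / a) = cnj b * s + b * t"
proof (cases "norm t \<le> norm s")
  case True
  have X: "\<bar>X\<bar> = norm s * norm t" by (metis assms norm_mult norm_of_real)
  have "X / s = t" using assms True by (cases "s = 0") (auto simp: field_simps)
  moreover have "\<bar>X\<bar> \<le> (norm s)\<^sup>2" using X True by (simp add: power2_eq_square mult_left_mono)
  ultimately show ?thesis by (intro that[of "cnj b" s]) auto
next
  case False
  have X: "\<bar>X\<bar> = norm s * norm t" by (metis assms norm_mult norm_of_real)
  have "X / t = s" using assms False by (cases "t = 0") (auto simp: field_simps)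
  moreover have "\<bar>X\<bar> \<le> (norm t)\<^sup>2" using X False by (simp add: power2_eq_square mult_right_mono)
  ultimately show ?thesis by (intro that[of b t]) (auto simp: algebra_simps)
qed

lemma curve_branch:
  assumes "curve b X X' y y'"
  obtains l l' a a' where "l \<in> {b, cnj b}" "l' \<in> {b, cnj b}"
    "branch l l' ((norm b)\<^sup>2) X X' y y' a a'"
proof -
  obtain s t s' t' where st: "s * t = of_real X" "s' * t' = of_real X'"
    "y = (s - b) * (t - cnj b)" "y' = (s' - b) * (t' - cnj b)"
    "(s - 1) * (t - 1) = (s' - 1) * (t' - 1)"
    using assms unfolding curve_def by blast
  obtain l and a :: complex where a: "l \<in> {b, cnj b}" "\<bar>X\<bar> \<le> (norm a)\<^sup>2" "a + X / a = s + t"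
    "l * a + cnj l * (X / a) = cnj b * s + b * t"
    by (rule dominant_factor[OF st(1)])
  obtain l' and a' :: complex where a': "l' \<in> {b, cnj b}" "\<bar>X'\<bar> \<le> (norm a')\<^sup>2" "a' + X' / a' = s' + t'"
    "l' * a' + cnj l' * (X' / a') = cnj b * s' + b * t'"
    by (rule dominant_factor[OF st(2)])
  have bb: "b * cnj b = of_real ((norm b)\<^sup>2)" by (rule complex_norm_square[symmetric])
  have y: "y = X + (norm b)\<^sup>2 - (cnj b * s + b * t)"
    using st(1) bb unfolding st(3) by (simp add: algebra_simps)
  have y': "y' = X' + (norm b)\<^sup>2 - (cnj b * s' + b * t')"
    using st(2) bb unfolding st(4) by (simp add: algebra_simps)
  have "X - (s + t) = X' - (s' + t')"
    using st(1,2,5) by (simp add: algebra_simps)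
  then have "X - a - X / a = X' - a' - X' / a'"
    by (simp only: a(3) a'(3) diff_diff_eq)
  moreover have "y = of_real (X + (norm b)\<^sup>2) - l * a - cnj l * (X / a)"
    by (simp only: y a(4) diff_diff_eq)
  moreover have "y' = of_real (X' + (norm b)\<^sup>2) - l' * a' - cnj l' * (X' / a')"
    by (simp only: y' a'(4) diff_diff_eq)
  ultimately have "branch l l' ((norm b)\<^sup>2) X X' y y' a a'"
    unfolding branch_def of_real_add[symmetric] using a(2) a'(2) by blast
  then show ?thesis using a(1) a'(1) by (intro that)
qed

text \<open>These are successive coefficients of the expansion of \<open>y'\<close> in powers of
  \<open>1/y\<close>: the slope, the constant term, the coefficient of \<open>1/y\<close>, and, for
  equal slopes, that of \<open>1/y^2\<close>. They follow from \<open>y\<close> being asymptotic to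
  \<open>- l * a\<close> and \<open>a' - a\<close> tending to \<open>X' - X\<close>. For
  \<open>l' = l\<close> the third limit is \<open>- l * (l - cnj l) * (X' - X)\<close>, which
  explains the correction in the fourth.\<close>

lemma branch_limits:
  fixes y y' a a' :: "nat \<Rightarrow> complex" and l l' :: complex and X X' \<rho> :: real
  assumes br: "\<And>n. branch l l' \<rho> X X' (y n) (y' n) (a n) (a' n)"
    and inf: "filterlim y at_infinity sequentially" and l: "l \<noteq> 0" "l' \<noteq> 0"
  defines "K0 \<equiv> X' * (1 - l') - X * (l'/l) * (1 - l) + \<rho> * (1 - l'/l)"
  shows "(\<lambda>n. y' n / y n) \<longlonglongrightarrow> l'/l"
    and "(\<lambda>n. y' n - l'/l * y n) \<longlonglongrightarrow> K0"
    and "(\<lambda>n. y n * (y' n - l'/l * y n - K0)) \<longlonglongrightarrow>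
        X * l' * (l - cnj l) - l * X' * (l' - cnj l')"
    and "l' = l \<Longrightarrow> (\<lambda>n. y n * (y n * (y' n - y n - K0) + l * (l - cnj l) * (X' - X))) \<longlonglongrightarrow>
        - l * (l - cnj l) * (X' - X) * (X + \<rho> + l * X')"
proof -
  have quot: "norm (of_real x / z) \<le> norm z" if "\<bar>x\<bar> \<le> (norm z)\<^sup>2" for x and z :: complex
    using that by (cases "z = 0") (auto simp: norm_divide divide_simps power2_eq_square)
  have q1: "norm (X / a n) \<le> norm (a n)" and q2: "norm (X' / a' n) \<le> norm (a' n)" for n
    using br[of n] quot unfolding branch_def by auto
  have ey: "y n = X + \<rho> - l * a n - cnj l * (X / a n)"
    and ey': "y' n = X' + \<rho> - l' * a' n - cnj l' * (X' / a' n)"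
    and ez: "X - a n - X / a n = X' - a' n - X' / a' n" for n
    using br[of n] unfolding branch_def by auto
  have ylim: "filterlim (\<lambda>n. norm (y n)) at_top sequentially"
    using inf by (simp add: filterlim_at_infinity_conv_norm_at_top)
  have at: "filterlim g at_infinity sequentially"
    if h: "filterlim (\<lambda>n. norm (h n)) at_top sequentially" and "c > 0"
      and le: "\<And>n. norm (h n) \<le> C + c * norm (g n)" for g h :: "nat \<Rightarrow> complex" and C c
    unfolding filterlim_at_infinity_conv_norm_at_top
  proof (rule filterlim_at_top_mono)
    show "filterlim (\<lambda>n. (- C + norm (h n)) * (1/c)) at_top sequentially"
      by (intro filterlim_at_top_mult_tendsto_pos[OF tendsto_const]
          filterlim_tendsto_add_at_top[OF tendsto_const h]) (use \<open>c > 0\<close> in auto)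
    show "\<forall>\<^sub>F n in sequentially. (- C + norm (h n)) * (1/c) \<le> norm (g n)"
      using le \<open>c > 0\<close> by (auto simp: field_simps intro!: always_eventually)
  qed
  \<comment> \<open>Dominance of \<open>a\<close> bounds \<open>X / a\<close> by \<open>a\<close>,
    so \<open>y\<close> can be large only if \<open>a\<close> is. The relation between
    \<open>a\<close> and \<open>a'\<close> then carries this over to \<open>a'\<close>.\<close>
  have ainf: "filterlim a at_infinity sequentially"
  proof (rule at[OF ylim])
    show "norm (y n) \<le> norm (of_real (X + \<rho>) :: complex) + (2 * norm l) * norm (a n)" for n
    proof -
      have "norm (y n) \<le> norm (of_real (X + \<rho>) :: complex) + norm (l * a n) + norm (cnj l * (X / a n))"
        unfolding ey[of n] by (meson add_mono norm_triangle_ineq4 order_refl order_trans)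
      moreover have "norm (cnj l * (X / a n)) \<le> norm l * norm (a n)"
        using q1[of n] by (simp only: norm_mult complex_mod_cnj mult_left_mono norm_ge_zero)
      moreover have "norm (l * a n) = norm l * norm (a n)" by (rule norm_mult)
      ultimately show ?thesis by linarith
    qed
  qed (use l in auto)
  have a0: "(\<lambda>n. c / a n) \<longlonglongrightarrow> 0" for c :: complex
    by (rule tendsto_divide_0[OF tendsto_const ainf])
  have einf: "filterlim (\<lambda>n. norm (a n + (X' - X + X / a n))) at_top sequentially"
    using tendsto_add_filterlim_at_infinity'[OF ainf tendsto_add[OF tendsto_const a0]]
    by (simp add: filterlim_at_infinity_conv_norm_at_top)
  have a'inf: "filterlim a' at_infinity sequentially"
  proof (rule at[OF einf])
    show "norm (a n + (X' - X + X / a n)) \<le> 0 + 2 * norm (a' n)" for n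
    proof -
      have "a n + (X' - X + X / a n) = a' n + X' / a' n" using ez[of n] by (simp add: algebra_simps)
      then show ?thesis using q2[of n] norm_triangle_ineq[of "a' n" "X' / a' n"] by simp
    qed
  qed auto
  have a'0: "(\<lambda>n. c / a' n) \<longlonglongrightarrow> 0" for c :: complex
    by (rule tendsto_divide_0[OF tendsto_const a'inf])
  have nz: "\<forall>\<^sub>F n in sequentially. a n \<noteq> 0 \<and> a' n \<noteq> 0 \<and> y n \<noteq> 0"
    using filterlim_at_infinity_imp_eventually_ne[OF ainf, of 0]
      filterlim_at_infinity_imp_eventually_ne[OF a'inf, of 0]
      filterlim_at_infinity_imp_eventually_ne[OF inf, of 0] by eventually_elim auto
  have tr: "g \<longlonglongrightarrow> L" if "h \<longlonglongrightarrow> L'" "L' = L"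
    "\<And>n. a n \<noteq> 0 \<and> a' n \<noteq> 0 \<and> y n \<noteq> 0 \<Longrightarrow> h n = g n" for g h :: "nat \<Rightarrow> complex" and L L'
    using Lim_transform_eventually[OF that(1) eventually_mono[OF nz that(3)]] that(2) by simp
  have ed: "a' n - a n = of_real (X' - X) + X / a n - X' / a' n" for n
    using ez[of n] by (simp add: algebra_simps)
  have d: "(\<lambda>n. a' n - a n) \<longlonglongrightarrow> of_real (X' - X)"
    unfolding ed using tendsto_diff[OF tendsto_add[OF tendsto_const a0] a'0] by simp
  have "(\<lambda>n. 1 - (a' n - a n) / a' n) \<longlonglongrightarrow> 1 - 0"
    by (intro tendsto_intros tendsto_divide_0[OF d a'inf])
  then have aa': "(\<lambda>n. a n / a' n) \<longlonglongrightarrow> 1"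
    by (rule tr) (auto simp: field_simps)
  have "(\<lambda>n. (X + \<rho>) / a n - l - cnj l * (X / a n) * (1 / a n)) \<longlonglongrightarrow> 0 - l - cnj l * 0 * 0"
    by (intro tendsto_intros a0)
  then have ya: "(\<lambda>n. y n / a n) \<longlonglongrightarrow> - l"
    by (rule tr) (auto simp: ey field_simps)
  \<comment> \<open>An exact identity: replacing \<open>a'\<close> by \<open>a\<close> plus the
    difference \<open>ed\<close> cancels the linear and constant terms and leaves only multiples of
    \<open>X / a\<close> and \<open>X' / a'\<close>.\<close>
  have E: "y' n - l'/l * y n - K0 = (X / a n) * ((l'/l) * (cnj l - l)) + (X' / a' n) * (l' - cnj l')" for n
  proof -
    have a': "a' n = a n + of_real (X' - X) + X / a n - X' / a' n"
      using ed[of n] by (simp add: algebra_simps)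
    have "y' n = X' + \<rho> - l' * (a n + of_real (X' - X) + X / a n - X' / a' n) - cnj l' * (X' / a' n)"
      using ey'[of n] a' by metis
    moreover define p where "p = X / a n"
    moreover define q where "q = X' / a' n"
    ultimately have 1: "y' n = X' + \<rho> - l' * (a n + of_real (X' - X) + p - q) - cnj l' * q"
      and 2: "y n = X + \<rho> - l * a n - cnj l * p" using ey[of n] by auto
    show ?thesis unfolding p_def[symmetric] q_def[symmetric] 1 2 K0_def
      using l by (simp add: field_simps)
  qed
  show l2: "(\<lambda>n. y' n - l'/l * y n) \<longlonglongrightarrow> K0"
  proof -
    have "(\<lambda>n. K0 + ((X / a n) * ((l'/l) * (cnj l - l)) + (X' / a' n) * (l' - cnj l'))) \<longlonglongrightarrow>
       K0 + (0 * ((l'/l) * (cnj l - l)) + 0 * (l' - cnj l'))"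
      by (intro tendsto_intros a0 a'0)
    moreover have "K0 + ((X / a n) * ((l'/l) * (cnj l - l)) + (X' / a' n) * (l' - cnj l')) = y' n - l'/l * y n" for n
      unfolding E[symmetric] by simp
    ultimately show ?thesis by simp
  qed
  show "(\<lambda>n. y' n / y n) \<longlonglongrightarrow> l'/l"
  proof -
    have "(\<lambda>n. l'/l + (y' n - l'/l * y n) / y n) \<longlonglongrightarrow> l'/l + 0"
      by (intro tendsto_intros tendsto_divide_0[OF l2 inf])
    then show ?thesis
      by (rule tr) (use l in \<open>auto simp: field_simps\<close>)
  qed
  show "(\<lambda>n. y n * (y' n - l'/l * y n - K0)) \<longlonglongrightarrow>
        X * l' * (l - cnj l) - l * X' * (l' - cnj l')"
  proof -
    have "(\<lambda>n. (y n / a n) * (X * ((l'/l) * (cnj l - l)) + X' * (a n / a' n) * (l' - cnj l'))) \<longlonglongrightarrow>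
       (- l) * (X * ((l'/l) * (cnj l - l)) + of_real X' * 1 * (l' - cnj l'))"
      by (intro tendsto_intros ya aa')
    then have "(\<lambda>n. y n * (y' n - l'/l * y n - K0)) \<longlonglongrightarrow>
       (- l) * (X * ((l'/l) * (cnj l - l)) + of_real X' * 1 * (l' - cnj l'))"
      by (rule tr[OF _ refl], subst E) (use l in \<open>simp add: divide_simps; simp add: algebra_simps\<close>)
    moreover have "(- l) * (X * ((l'/l) * (cnj l - l)) + of_real X' * 1 * (l' - cnj l')) =
      X * l' * (l - cnj l) - l * X' * (l' - cnj l')"
      using l by (simp add: field_simps)
    ultimately show ?thesis by simp
  qed
  show "(\<lambda>n. y n * (y n * (y' n - y n - K0) + l * (l - cnj l) * (X' - X))) \<longlonglongrightarrow>
        - l * (l - cnj l) * (X' - X) * (X + \<rho> + l * X')" if "l' = l"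
  proof -
    define \<delta> :: complex where "\<delta> = of_real (X' - X)"
    have "y n + l * a n = of_real (X + \<rho>) - cnj l * (X / a n)" for n
      unfolding ey by simp
    moreover have "(\<lambda>n. of_real (X + \<rho>) - cnj l * (X / a n)) \<longlonglongrightarrow> of_real (X + \<rho>) - cnj l * 0"
      by (intro tendsto_intros a0)
    ultimately have yl: "(\<lambda>n. y n + l * a n) \<longlonglongrightarrow> X + \<rho>"
      by simp
    \<comment> \<open>Over the common denominator \<open>a'\<close>, the numerator is regrouped so
      that the divergent \<open>y\<close> and \<open>a\<close> occur only in the convergent
      combinations \<open>y + l * a\<close>, \<open>a' - a\<close> and \<open>y / a\<close>.\<close>
    define N where "N = (\<lambda>n. \<delta> * (y n + l * a n) - X * (a' n - a n) * (y n / a n) + l * \<delta> * (a' n - a n))"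
    have "N \<longlonglongrightarrow> \<delta> * (X + \<rho>) - X * \<delta> * (- l) + l * \<delta> * \<delta>"
      unfolding N_def \<delta>_def by (intro tendsto_intros yl ya d)
    then have "(\<lambda>n. (y n / a n) * (a n / a' n) * (l - cnj l) * N n) \<longlonglongrightarrow>
       (- l) * 1 * (l - cnj l) * (\<delta> * (X + \<rho>) - X * \<delta> * (- l) + l * \<delta> * \<delta>)"
      by (intro tendsto_intros ya aa')
    then have "(\<lambda>n. y n * (y n * (y' n - y n - K0) + l * (l - cnj l) * (X' - X))) \<longlonglongrightarrow>
       (- l) * 1 * (l - cnj l) * (\<delta> * (X + \<rho>) - X * \<delta> * (- l) + l * \<delta> * \<delta>)"
    proof (rule tr[OF _ refl])
      fix n assume n: "a n \<noteq> 0 \<and> a' n \<noteq> 0 \<and> y n \<noteq> 0"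
      have e: "y' n - y n - K0 = (l - cnj l) * (X' / a' n - X / a n)"
      proof -
        have "p * (v - u) + q * (u - v) = (u - v) * (q - p)" for p q u v :: complex
          by (simp add: algebra_simps)
        moreover have "y' n - y n - K0 = (X / a n) * (cnj l - l) + (X' / a' n) * (l - cnj l)"
          using E[of n] l unfolding that by (simp only: divide_self mult_1 not_False_eq_True)
        ultimately show ?thesis by (simp only:)
      qed
      show "(y n / a n) * (a n / a' n) * (l - cnj l) * N n =
        y n * (y n * (y' n - y n - K0) + l * (l - cnj l) * (X' - X))"
        unfolding e N_def using n by (simp add: divide_simps) (simp add: \<delta>_def algebra_simps)
    qed
    moreover have "(- l) * 1 * (l - cnj l) * (\<delta> * (X + \<rho>) - X * \<delta> * (- l) + l * \<delta> * \<delta>) =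
       - l * (l - cnj l) * (X' - X) * (X + \<rho> + l * X')"
      unfolding \<delta>_def by (simp add: algebra_simps)
    ultimately show ?thesis by (simp only:)
  qed
qed

text \<open>Both branches describe the same sequence, so their expansion coefficients coincide. The
  cases run over which slopes are equal and which are conjugate.\<close>

lemma two_branches_agree:
  fixes y y' a a' c c' :: "nat \<Rightarrow> complex" and X X' U U' \<rho> :: real
  assumes b: "Re b \<noteq> 0" "Im b \<noteq> 0"
    and mem: "l \<in> {b, cnj b}" "l' \<in> {b, cnj b}" "m \<in> {b, cnj b}" "m' \<in> {b, cnj b}"
    and br: "\<And>n. branch l l' \<rho> X X' (y n) (y' n) (a n) (a' n)"
      "\<And>n. branch m m' \<rho> U U' (y n) (y' n) (c n) (c' n)"
    and inf: "filterlim y at_infinity sequentially" and ne: "X \<noteq> X'" "U \<noteq> U'"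
  shows "X = U \<and> X' = U'"
proof -
  have nz: "l \<noteq> 0" "l' \<noteq> 0" "m \<noteq> 0" "m' \<noteq> 0" using mem b by (auto simp: complex_eq_iff)
  note L = branch_limits[OF br(1) inf nz(1,2)] and M = branch_limits[OF br(2) inf nz(3,4)]
  have k: "l'/l = m'/m" using LIMSEQ_unique[OF L(1) M(1)] .
  define K where "K = of_real X' * (1 - l') - of_real X * (l'/l) * (1 - l) + of_real \<rho> * (1 - l'/l)"
  have K: "K = of_real U' * (1 - m') - of_real U * (m'/m) * (1 - m) + of_real \<rho> * (1 - m'/m)"
    using LIMSEQ_unique[OF L(2)[folded K_def] M(2)[folded k]] unfolding k by simp
  have K1: "X * l' * (l - cnj l) - l * X' * (l' - cnj l') = U * m' * (m - cnj m) - m * U' * (m' - cnj m')"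
    using LIMSEQ_unique[OF L(3)[folded K_def] M(3)[folded K, folded k]] .
  \<comment> \<open>A number off both coordinate axes is linearly independent of its conjugate over
    the reals; this is where a right angle at the origin must be excluded.\<close>
  have lin: "x = u \<and> x' = u'" if "of_real x * z + of_real x' * cnj z = of_real u * z + of_real u' * cnj z"
    "Re z \<noteq> 0" "Im z \<noteq> 0" for x x' u u' :: real and z
  proof -
    have "(x + x') * Re z = (u + u') * Re z" "(x - x') * Im z = (u - u') * Im z"
      using that(1) by (auto simp: complex_eq_iff algebra_simps)
    then show ?thesis using that by auto
  qed
  have bl: "Re l \<noteq> 0" "Im l \<noteq> 0" using mem b by auto
  have ll: "l - cnj l \<noteq> 0" using bl by (simp add: complex_eq_iff)
  show ?thesis
  proof (cases "l' = l")
    case True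
    then have mm: "m' = m" using k nz by simp
    consider "m = l" | "m = cnj l" using mem by auto
    then show ?thesis
    proof cases
      \<comment> \<open>The constant term fixes \<open>X' - X\<close>. The coefficient of
        \<open>1/y\<close> would only repeat this, so the next one is used: it fixes
        \<open>X + l * X'\<close>, and \<open>l\<close> is not real.\<close>
      case 1
      have l1: "1 - l \<noteq> 0" using bl by (auto simp: complex_eq_iff)
      have d: "X' - X = U' - U"
      proof -
        have "(of_real (X' - X) - of_real (U' - U)) * (1 - l) = 0"
          using K nz unfolding K_def True mm 1 by (simp add: algebra_simps)
        then show ?thesis using l1 by (metis eq_iff_diff_eq_0 mult_eq_0_iff of_real_eq_iff)
      qed
      have "- l * (l - cnj l) * (X' - X) * (X + \<rho> + l * X') = - l * (l - cnj l) * (U' - U) * (U + \<rho> + l * U')"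
        using LIMSEQ_unique[OF L(4)[OF True, folded K_def] M(4)[OF mm, folded K, unfolded 1, folded d]]
        unfolding d .
      then have "X + l * X' = U + l * U'"
        unfolding d using nz ll ne d by simp
      then show ?thesis using bl by (auto simp: complex_eq_iff)
    next
      \<comment> \<open>Conjugate slopes would give a real linear relation between \<open>l\<close>
        and \<open>cnj l\<close> with coefficients \<open>X - X'\<close> and \<open>U - U'\<close>,
        both nonzero.\<close>
      case 2
      have "(l - cnj l) * (of_real (X - X') * l + of_real (U - U') * cnj l) = 0"
        using K1 unfolding True mm 2 by (simp add: algebra_simps)
      then have "of_real (X - X') * l + of_real (U - U') * cnj l = of_real 0 * l + of_real 0 * cnj l"
        using ll by simp
      then have False using lin[OF _ bl] ne by fastforce
      then show ?thesis ..
    qed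
  next
    \<comment> \<open>The ratio of slopes is now \<open>cnj l / l\<close>. It differs from its
      inverse because \<open>l^2\<close> is not real, which forces \<open>m = l\<close>; the
      coefficient of \<open>1/y\<close> then fixes both parameters at once.\<close>
    case False
    then have l': "l' = cnj l" using mem by auto
    have "m' = cnj m"
      using k False nz mem by auto
    moreover have "m = l"
    proof (rule ccontr)
      assume "m \<noteq> l"
      then have "m = cnj l" using mem by auto
      then have "cnj l * cnj l = l * l" using k l' nz \<open>m' = cnj m\<close> by (simp add: field_simps)
      then have "Re l * Im l = 0" by (auto simp: complex_eq_iff)
      then show False using bl by simp
    qed
    ultimately have "(l - cnj l) * (X' * l + X * cnj l) = (l - cnj l) * (U' * l + U * cnj l)"
      using K1 unfolding l' by (simp add: algebra_simps)
    then show ?thesis using lin[OF _ bl] ll by auto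
  qed
qed

text \<open>Otherwise every natural number \<open>y\<close> would have a common \<open>y'\<close>.
  There are finitely many choices of the four slopes, so one choice recurs infinitely often, and
  along that subsequence two branches agree at infinity.\<close>

lemma curves_not_everywhere:
  assumes b: "Re b \<noteq> 0" "Im b \<noteq> 0" and ne: "X \<noteq> X'" "U \<noteq> U'" "(X, X') \<noteq> (U, U')"
  shows "\<exists>y. \<nexists>y'. curve b X X' y y' \<and> curve b U U' y y'"
proof (rule ccontr)
  assume neg: "\<not> ?thesis"
  define \<rho> where "\<rho> = (norm b)\<^sup>2"
  define T where "T = {b, cnj b} \<times> {b, cnj b} \<times> {b, cnj b} \<times> {b, cnj b}"
  define Q where "Q = (\<lambda>n (l, l', m, m'). \<exists>y' a a' c c'.
      branch l l' \<rho> X X' (of_nat n) y' a a' \<and> branch m m' \<rho> U U' (of_nat n) y' c c')"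
  have "\<forall>n. \<exists>w \<in> T. Q n w"
  proof
    fix n
    obtain y' where c: "curve b X X' (of_nat n) y'" "curve b U U' (of_nat n) y'"
      using neg by blast
    obtain l l' a a' where 1: "l \<in> {b, cnj b}" "l' \<in> {b, cnj b}" "branch l l' \<rho> X X' (of_nat n) y' a a'"
      by (rule curve_branch[OF c(1), folded \<rho>_def])
    obtain m m' c c' where 2: "m \<in> {b, cnj b}" "m' \<in> {b, cnj b}" "branch m m' \<rho> U U' (of_nat n) y' c c'"
      by (rule curve_branch[OF c(2), folded \<rho>_def])
    show "\<exists>w \<in> T. Q n w"
    proof
      show "Q n (l, l', m, m')" unfolding Q_def prod.case using 1(3) 2(3) by blast
    qed (unfold T_def, intro SigmaI 1 2)
  qed
  then obtain f where f: "\<And>n. f n \<in> T" "\<And>n. Q n (f n)"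
    unfolding Bex_def choice_iff by blast
  then have "range f \<subseteq> T" by blast
  then have "finite (range f)" by (rule finite_subset) (simp add: T_def)
  then obtain n0 where inf: "infinite {n. f n = f n0}"
    using pigeonhole_infinite[of UNIV f] by auto
  obtain l l' m m' where f0: "f n0 = (l, l', m, m')" by (metis prod_cases4)
  define r where "r = enumerate {n. f n = f n0}"
  have fr: "f (r n) = (l, l', m, m')" for n
    using enumerate_in_set[OF inf, of n] f0 by (simp add: r_def)
  have mem: "l \<in> {b, cnj b}" "l' \<in> {b, cnj b}" "m \<in> {b, cnj b}" "m' \<in> {b, cnj b}"
    using f(1)[of n0] f0 by (auto simp: T_def)
  have "\<forall>n. \<exists>y' a a' c c'. branch l l' \<rho> X X' (of_nat (r n)) y' a a' \<and> branch m m' \<rho> U U' (of_nat (r n)) y' c c'"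
  proof
    fix n
    have "Q (r n) (l, l', m, m')" using f(2)[of "r n"] by (simp only: fr)
    then show "\<exists>y' a a' c c'. branch l l' \<rho> X X' (of_nat (r n)) y' a a' \<and>
        branch m m' \<rho> U U' (of_nat (r n)) y' c c'"
      unfolding Q_def prod.case .
  qed
  then obtain y' a a' c c' where
    br: "\<And>n. branch l l' \<rho> X X' (of_nat (r n)) (y' n) (a n) (a' n)"
      "\<And>n. branch m m' \<rho> U U' (of_nat (r n)) (y' n) (c n) (c' n)"
    by metis
  have "strict_mono r" using strict_mono_enumerate[OF inf] by (simp add: r_def)
  then have lim: "filterlim (\<lambda>n. of_nat (r n) :: complex) at_infinity sequentially"
    by (intro filterlim_compose[OF tendsto_of_nat] filterlim_subseq)
  have "X = U \<and> X' = U'"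
    by (rule two_branches_agree[OF b mem br lim ne(1,2)])
  then show False using ne by simp
qed

section \<open>Elimination\<close>

text \<open>The difference of the two sides is the product of \<open>D - w - v\<close> over all
  signs of the roots \<open>w\<close> and \<open>v\<close>. A vanishing factor gives the required
  roots after sign changes.\<close>

lemma difference_of_roots:
  fixes D E F :: complex
  shows "(\<exists>w v. w\<^sup>2 = E \<and> v\<^sup>2 = F \<and> D = w - v) \<longleftrightarrow> (D\<^sup>2 - E - F)\<^sup>2 = 4 * E * F"
proof
  assume "(D\<^sup>2 - E - F)\<^sup>2 = 4 * E * F"
  define w v where "w = csqrt E" and "v = csqrt F"
  have wv: "w\<^sup>2 = E" "v\<^sup>2 = F" by (auto simp: w_def v_def)
  have "(D - w - v) * (D + w + v) * ((D - w + v) * (D + w - v)) = (D\<^sup>2 - E - F)\<^sup>2 - 4 * E * F"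
    unfolding wv[symmetric] by (simp add: algebra_simps power2_eq_square)
  then have "(D - w - v) * (D + w + v) * ((D - w + v) * (D + w - v)) = 0"
    using \<open>(D\<^sup>2 - E - F)\<^sup>2 = 4 * E * F\<close> by simp
  then have "D - w - v = 0 \<or> D + w + v = 0 \<or> D - w + v = 0 \<or> D + w - v = 0"
    unfolding mult_eq_0_iff by blast
  then have "D = w - (- v) \<or> D = - w - v \<or> D = w - v \<or> D = - w - (- v)"
    by (auto simp: diff_eq_eq add_eq_0_iff)
  moreover have "(- w)\<^sup>2 = E" "(- v)\<^sup>2 = F" using wv by auto
  ultimately show "\<exists>w v. w\<^sup>2 = E \<and> v\<^sup>2 = F \<and> D = w - v"
    using wv by blast
qed (auto simp: algebra_simps power2_eq_square)

section \<open>Eliminating two square roots with control of the degree\<close>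

text \<open>Only values on the locus of the two square roots matter, so a function is recorded
  modulo those relations: it lies in the span of \<open>1\<close>, \<open>u\<close>,
  \<open>v\<close>, \<open>u * v\<close> over polynomials in \<open>y\<close> of degree at most
  \<open>d\<close>.\<close>

definition biquadratic :: "nat \<Rightarrow> complex poly \<Rightarrow> complex poly \<Rightarrow> (complex \<Rightarrow> complex \<Rightarrow> complex \<Rightarrow> complex) \<Rightarrow> bool" where
  "biquadratic d P Q h \<longleftrightarrow> (\<exists>A B C D. degree A \<le> d \<and> degree B \<le> d \<and> degree C \<le> d \<and> degree D \<le> d \<and>
     (\<forall>y u v. u\<^sup>2 = poly P y \<longrightarrow> v\<^sup>2 = poly Q y \<longrightarrow>
        h y u v = poly A y + poly B y * u + poly C y * v + poly D y * (u * v)))"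

lemma biquadratic_linear:
  assumes "degree A \<le> d"
  shows "biquadratic d P Q (\<lambda>y u v. poly A y + b * u + c * v)"
  unfolding biquadratic_def
  by (rule exI[of _ A], rule exI[of _ "[:b:]"], rule exI[of _ "[:c:]"], rule exI[of _ 0]) (use assms in auto)

lemma biquadratic_diff:
  assumes "biquadratic d P Q h" "biquadratic e P Q k"
  shows "biquadratic (max d e) P Q (\<lambda>y u v. h y u v - k y u v)"
proof -
  obtain A B C D where 1: "degree A \<le> d" "degree B \<le> d" "degree C \<le> d" "degree D \<le> d"
    "\<And>y u v. u\<^sup>2 = poly P y \<Longrightarrow> v\<^sup>2 = poly Q y \<Longrightarrow>
        h y u v = poly A y + poly B y * u + poly C y * v + poly D y * (u * v)"
    using assms(1) unfolding biquadratic_def by blast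
  obtain A' B' C' D' where 2: "degree A' \<le> e" "degree B' \<le> e" "degree C' \<le> e" "degree D' \<le> e"
    "\<And>y u v. u\<^sup>2 = poly P y \<Longrightarrow> v\<^sup>2 = poly Q y \<Longrightarrow>
        k y u v = poly A' y + poly B' y * u + poly C' y * v + poly D' y * (u * v)"
    using assms(2) unfolding biquadratic_def by blast
  have "degree (p - q) \<le> max d e" if "degree p \<le> d" "degree q \<le> e" for p q :: "complex poly"
    using that by (intro degree_diff_le) auto
  then show ?thesis unfolding biquadratic_def using 1 2
    by (intro exI[of _ "A - A'"] exI[of _ "B - B'"] exI[of _ "C - C'"] exI[of _ "D - D'"])
       (auto simp: algebra_simps)
qed

text \<open>Reducing \<open>u^2\<close> and \<open>v^2\<close> in a product introduces factors
  \<open>P\<close> and \<open>Q\<close>, at worst both, which accounts for the extra 4.\<close>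

lemma biquadratic_mult:
  assumes "biquadratic d P Q h" "biquadratic e P Q k" and deg: "degree P \<le> 2" "degree Q \<le> 2"
  shows "biquadratic (d + e + 4) P Q (\<lambda>y u v. h y u v * k y u v)"
proof -
  obtain A B C D where 1: "degree A \<le> d" "degree B \<le> d" "degree C \<le> d" "degree D \<le> d"
    "\<And>y u v. u\<^sup>2 = poly P y \<Longrightarrow> v\<^sup>2 = poly Q y \<Longrightarrow>
        h y u v = poly A y + poly B y * u + poly C y * v + poly D y * (u * v)"
    using assms(1) unfolding biquadratic_def by blast
  obtain A' B' C' D' where 2: "degree A' \<le> e" "degree B' \<le> e" "degree C' \<le> e" "degree D' \<le> e"
    "\<And>y u v. u\<^sup>2 = poly P y \<Longrightarrow> v\<^sup>2 = poly Q y \<Longrightarrow>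
        k y u v = poly A' y + poly B' y * u + poly C' y * v + poly D' y * (u * v)"
    using assms(2) unfolding biquadratic_def by blast
  have pq: "degree (P * Q) \<le> 4" using degree_mult_le[of P Q] deg by linarith
  have m: "degree (p * q) \<le> d + e + 4" if "degree p \<le> d" "degree q \<le> e" for p q :: "complex poly"
    using that degree_mult_le[of p q] by linarith
  have m3: "degree (p * q * r) \<le> d + e + 4" if "degree p \<le> d" "degree q \<le> e" "degree r \<le> 4" for p q r :: "complex poly"
    using that degree_mult_le[of p q] degree_mult_le[of "p * q" r] by linarith
  have deg': "degree P \<le> 4" "degree Q \<le> 4" using deg by auto
  define A'' where "A'' = A * A' + B * B' * P + C * C' * Q + D * D' * (P * Q)"
  define B'' where "B'' = A * B' + B * A' + C * D' * Q + D * C' * Q"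
  define C'' where "C'' = A * C' + C * A' + B * D' * P + D * B' * P"
  define D'' where "D'' = A * D' + D * A' + B * C' + C * B'"
  have "h y u v * k y u v = poly A'' y + poly B'' y * u + poly C'' y * v + poly D'' y * (u * v)"
    if "u\<^sup>2 = poly P y" "v\<^sup>2 = poly Q y" for y u v
    unfolding 1(5)[OF that] 2(5)[OF that] A''_def B''_def C''_def D''_def
    by (simp add: that[symmetric] algebra_simps power2_eq_square)
  moreover have "degree A'' \<le> d + e + 4 \<and> degree B'' \<le> d + e + 4 \<and> degree C'' \<le> d + e + 4 \<and> degree D'' \<le> d + e + 4"
    unfolding A''_def B''_def C''_def D''_def
    by (rule conjI degree_add_le m3 m 1(1-4) 2(1-4) pq deg')+
  ultimately show ?thesis unfolding biquadratic_def by blast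
qed

text \<open>\<open>G\<close> is the norm of \<open>h\<close>, its product over all signs of
  \<open>u\<close> and \<open>v\<close>. Multiplying over the signs of \<open>v\<close> gives
  \<open>R + S * u\<close>; multiplying over those of \<open>u\<close> then gives
  \<open>R^2 - S^2 * P\<close>.\<close>

lemma eliminate_square_roots:
  assumes "biquadratic d P Q h" and deg: "degree P \<le> 2" "degree Q \<le> 2"
  obtains G where "degree G \<le> 4 * d + 10"
    "\<And>y. poly G y = 0 \<longleftrightarrow> (\<exists>u v. u\<^sup>2 = poly P y \<and> v\<^sup>2 = poly Q y \<and> h y u v = 0)"
proof -
  obtain A B C D where 1: "degree A \<le> d" "degree B \<le> d" "degree C \<le> d" "degree D \<le> d"
    "\<And>y u v. u\<^sup>2 = poly P y \<Longrightarrow> v\<^sup>2 = poly Q y \<Longrightarrow>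
        h y u v = poly A y + poly B y * u + poly C y * v + poly D y * (u * v)"
    using assms(1) unfolding biquadratic_def by blast
  define R where "R = A * A + B * B * P - C * C * Q - D * D * (P * Q)"
  define S where "S = A * B - C * D * Q + (A * B - C * D * Q)"
  define G where "G = R * R - S * S * P"
  have m: "degree (p * q * r) \<le> i + j + k" if "degree p \<le> i" "degree q \<le> j" "degree r \<le> k" for p q r :: "complex poly" and i j k
    using that degree_mult_le[of p q] degree_mult_le[of "p * q" r] by linarith
  have m2: "degree (p * q) \<le> i + j" if "degree p \<le> i" "degree q \<le> j" for p q :: "complex poly" and i j
    using that degree_mult_le[of p q] by linarith
  have "degree R \<le> 2 * d + 4"
    unfolding R_def using m2[OF 1(1) 1(1)] m[OF 1(2) 1(2) deg(1)] m[OF 1(3) 1(3) deg(2)] m[OF 1(4) 1(4) m2[OF deg]]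
    by (intro degree_add_le degree_diff_le) linarith+
  moreover have "degree S \<le> 2 * d + 4"
    unfolding S_def using m2[OF 1(1) 1(2)] m[OF 1(3) 1(4) deg(2)]
    by (intro degree_add_le degree_diff_le) linarith+
  ultimately have "degree G \<le> 4 * d + 10"
    unfolding G_def using m2[of R "2*d+4" R "2*d+4"] m[of S "2*d+4" S "2*d+4" P 2] deg
    by (intro degree_diff_le) linarith+
  moreover have "poly G y = 0 \<longleftrightarrow> (\<exists>u v. u\<^sup>2 = poly P y \<and> v\<^sup>2 = poly Q y \<and> h y u v = 0)" for y
  proof -
    define a b c e where "a = poly A y" and "b = poly B y" and "c = poly C y" and "e = poly D y"
    define k where "k = (\<lambda>u v. a + b * u + c * v + e * (u * v))"
    have k: "h y u v = k u v" if "u\<^sup>2 = poly P y" "v\<^sup>2 = poly Q y" for u v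
      using 1(5)[OF that] by (simp add: k_def a_def b_def c_def e_def)
    have G: "poly G y = k u v * k u (- v) * (k (- u) v * k (- u) (- v))"
      if "u\<^sup>2 = poly P y" "v\<^sup>2 = poly Q y" for u v
    proof -
      have "k u v * k u (- v) = (a*a + b*b* u\<^sup>2 - c*c* v\<^sup>2 - e*e*(u\<^sup>2* v\<^sup>2)) + 2*(a*b - c*e* v\<^sup>2)*u"
        by (simp add: k_def power2_eq_square algebra_simps)
      moreover have "k (- u) v * k (- u) (- v) = (a*a + b*b* u\<^sup>2 - c*c* v\<^sup>2 - e*e*(u\<^sup>2* v\<^sup>2)) - 2*(a*b - c*e* v\<^sup>2)*u"
        by (simp add: k_def power2_eq_square algebra_simps)
      moreover have "(p + 2*q*u) * (p - 2*q*u) = p*p - (q+q)*(q+q)* u\<^sup>2" for p q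
        by (simp add: power2_eq_square algebra_simps)
      ultimately show ?thesis
        by (simp only: G_def R_def S_def that a_def b_def c_def e_def poly_diff poly_mult poly_add)
    qed
    show ?thesis
    proof
      define u v where "u = csqrt (poly P y)" and "v = csqrt (poly Q y)"
      have uv: "u\<^sup>2 = poly P y" "v\<^sup>2 = poly Q y" by (auto simp: u_def v_def)
      assume "poly G y = 0"
      then have "k u v = 0 \<or> k u (- v) = 0 \<or> k (- u) v = 0 \<or> k (- u) (- v) = 0"
        using G[OF uv] by auto
      then show "\<exists>u v. u\<^sup>2 = poly P y \<and> v\<^sup>2 = poly Q y \<and> h y u v = 0"
        using k uv by (metis power2_minus)
    next
      assume "\<exists>u v. u\<^sup>2 = poly P y \<and> v\<^sup>2 = poly Q y \<and> h y u v = 0"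
      then show "poly G y = 0" using G k by fastforce
    qed
  qed
  ultimately show ?thesis using that by blast
qed

section \<open>Common points of two curves as roots of a polynomial\<close>

text \<open>Here \<open>u = cnj b * s - b * t\<close> and \<open>w = s' - t'\<close>.\<close>
lemma curve_param:
  fixes b y y' :: complex and X X' :: real
  assumes b: "b \<noteq> 0"
  defines "f \<equiv> of_real X + b * cnj b - y"
  shows "curve b X X' y y' \<longleftrightarrow> (\<exists>u w. u\<^sup>2 = f\<^sup>2 - 4 * (b * cnj b) * of_real X \<and>
     w\<^sup>2 = (of_real (X' - X) + (1 / cnj b + 1 / b) / 2 * f + (1 / cnj b - 1 / b) / 2 * u)\<^sup>2 - 4 * of_real X' \<and>
     y' = of_real X' + b * cnj b
        - (cnj b + b) / 2 * (of_real (X' - X) + (1 / cnj b + 1 / b) / 2 * f + (1 / cnj b - 1 / b) / 2 * u)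
        - (cnj b - b) / 2 * w)"
    (is "_ = (\<exists>u w. ?A u \<and> w\<^sup>2 = (?E u)\<^sup>2 - _ \<and> _ = _ - _ * ?E u - _ )")
proof
  assume "curve b X X' y y'"
  then obtain s t s' t' where st: "s * t = of_real X" "s' * t' = of_real X'"
    "y = (s - b) * (t - cnj b)" "y' = (s' - b) * (t' - cnj b)"
    "(s - 1) * (t - 1) = (s' - 1) * (t' - 1)"
    unfolding curve_def by blast
  define u where "u = cnj b * s - b * t"
  have f: "f = cnj b * s + b * t" unfolding f_def st(1)[symmetric] st(3) by (simp add: algebra_simps)
  have "(1 / cnj b + 1 / b) / 2 * f + (1 / cnj b - 1 / b) / 2 * u = s + t"
    unfolding f u_def using b by (simp add: field_simps)
  then have E: "?E u = s' + t'" using st(1,2,5) by (simp add: algebra_simps)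
  have 1: "u\<^sup>2 = f\<^sup>2 - 4 * (b * cnj b) * of_real X"
    unfolding f u_def st(1)[symmetric] by (simp add: power2_eq_square algebra_simps)
  show "\<exists>u w. ?A u \<and> w\<^sup>2 = (?E u)\<^sup>2 - 4 * of_real X' \<and> y' = of_real X' + b * cnj b - (cnj b + b) / 2 * ?E u - (cnj b - b) / 2 * w"
    by (rule exI[of _ u], rule exI[of _ "s' - t'"], unfold E)
       (use 1 in \<open>auto simp: st(2)[symmetric] st(4) power2_eq_square algebra_simps add_divide_distrib diff_divide_distrib\<close>)
next
  assume "\<exists>u w. ?A u \<and> w\<^sup>2 = (?E u)\<^sup>2 - 4 * of_real X' \<and> y' = of_real X' + b * cnj b - (cnj b + b) / 2 * ?E u - (cnj b - b) / 2 * w"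
  then obtain u w where u: "?A u" and w: "w\<^sup>2 = (?E u)\<^sup>2 - 4 * of_real X'"
    and y': "y' = of_real X' + b * cnj b - (cnj b + b) / 2 * ?E u - (cnj b - b) / 2 * w" by blast
  define e where "e = ?E u"
  note w = w[folded e_def] and y' = y'[folded e_def]
  \<comment> \<open>These solve the linear systems with sum \<open>f\<close> and difference
    \<open>u\<close> for \<open>cnj b * s\<close> and \<open>b * t\<close>, and with sum
    \<open>e\<close> and difference \<open>w\<close> for \<open>s'\<close> and
    \<open>t'\<close>.\<close>
  define s t s' t' where "s = (f + u) / (2 * cnj b)" and "t = (f - u) / (2 * b)"
    and "s' = (e + w) / 2" and "t' = (e - w) / 2"
  note defs = s_def t_def s'_def t'_def
  have "s * t = (f\<^sup>2 - u\<^sup>2) / (4 * (b * cnj b))"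
    using b by (simp add: defs power2_eq_square field_simps)
  then have 1: "s * t = of_real X" using u b by simp
  have "s' * t' = ((e)\<^sup>2 - w\<^sup>2) / 4"
    unfolding defs power2_eq_square by (simp add: field_simps)
  then have 2: "s' * t' = of_real X'" using w by simp
  have "cnj b * s = (f + u) / 2" "b * t = (f - u) / 2" using b by (auto simp: defs)
  then have f: "cnj b * s + b * t = f" by (simp add: add_divide_distrib diff_divide_distrib)
  have 3: "y = (s - b) * (t - cnj b)"
    using 1 f unfolding f_def by (simp add: algebra_simps)
  have E: "s' + t' = e" "s' - t' = w" unfolding defs by (simp_all add: field_simps)
  have st: "s + t = (1 / cnj b + 1 / b) / 2 * f + (1 / cnj b - 1 / b) / 2 * u"
    using b by (simp add: defs field_simps)
  have 4: "y' = (s' - b) * (t' - cnj b)"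
    unfolding y' E[symmetric] 2[symmetric] by (simp add: field_simps)
  have "of_real X - (s + t) = of_real X' - (s' + t')"
    unfolding E st by (simp add: e_def)
  then have "(s - 1) * (t - 1) = (s' - 1) * (t' - 1)"
    using 1 2 by (simp add: algebra_simps)
  then show "curve b X X' y y'" unfolding curve_def using 1 2 3 4 by blast
qed

text \<open>Equating the two expressions for \<open>y'\<close> says that \<open>D\<close> is a
  difference of square roots of two \<open>F\<close>-values. \<open>difference_of_roots\<close>
  removes these, and the norm of the resulting \<open>h\<close> removes the inner roots
  \<open>u\<close> and \<open>v\<close>.\<close>

lemma common_curve_poly:
  assumes b: "b \<noteq> 0" "b \<noteq> cnj b"
  obtains G where "degree G \<le> 122"
    "\<forall>y. poly G y = 0 \<longleftrightarrow> (\<exists>y'. curve b X X' y y' \<and> curve b U U' y y')"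
proof -
  define \<rho> \<alpha> \<gamma> c a where "\<rho> = b * cnj b" and "\<alpha> = (1 / cnj b + 1 / b) / 2" and "\<gamma> = (1 / cnj b - 1 / b) / 2"
    and "c = (cnj b - b) / 2" and "a = (cnj b + b) / 2"
  have c: "c \<noteq> 0" using b by (simp add: c_def)
  define p where "p = (\<lambda>X. [:of_real X + \<rho>, -1:])"
  define P where "P = (\<lambda>X. p X * p X - [:4 * \<rho> * of_real X:])"
  define E where "E = (\<lambda>X X' y u. of_real (X' - X) + \<alpha> * poly (p X) y + \<gamma> * u)"
  \<comment> \<open>The factor \<open>c\<^sup>2\<close> is included so that the roots of
    \<open>F\<close> are \<open>c * w\<close>, the terms actually occurring in
    \<open>y'\<close>.\<close>
  define F where "F = (\<lambda>X X' y u. c\<^sup>2 * ((E X X' y u)\<^sup>2 - 4 * of_real X'))"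
  define D where "D = (\<lambda>y u v. of_real (X' - U') - a * (E X X' y u - E U U' y v))"
  define h where "h = (\<lambda>y u v. ((D y u v)\<^sup>2 - F X X' y u - F U U' y v)\<^sup>2 - 4 * F X X' y u * F U U' y v)"
  have pp: "poly (p X) y = of_real X + \<rho> - y" for X y by (simp add: p_def)
  have pP: "poly (P X) y = (of_real X + \<rho> - y)\<^sup>2 - 4 * \<rho> * of_real X" for X y
    by (simp add: P_def pp power2_eq_square)
  have par: "curve b X X' y y' \<longleftrightarrow> (\<exists>u w. u\<^sup>2 = poly (P X) y \<and> w\<^sup>2 = (E X X' y u)\<^sup>2 - 4 * of_real X' \<and>
      y' = of_real X' + \<rho> - a * E X X' y u - c * w)" for X X' y y'
    unfolding pP E_def pp unfolding \<rho>_def \<alpha>_def \<gamma>_def c_def a_def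
    by (rule curve_param[OF b(1)])
  have ex: "(\<exists>y'. curve b X X' y y' \<and> curve b U U' y y') \<longleftrightarrow>
      (\<exists>u v. u\<^sup>2 = poly (P X) y \<and> v\<^sup>2 = poly (P U) y \<and> h y u v = 0)" for y
  proof -
    have "(\<exists>y'. curve b X X' y y' \<and> curve b U U' y y') \<longleftrightarrow> (\<exists>u v. u\<^sup>2 = poly (P X) y \<and> v\<^sup>2 = poly (P U) y \<and>
       (\<exists>w x. w\<^sup>2 = (E X X' y u)\<^sup>2 - 4 * of_real X' \<and> x\<^sup>2 = (E U U' y v)\<^sup>2 - 4 * of_real U' \<and>
         of_real X' + \<rho> - a * E X X' y u - c * w = of_real U' + \<rho> - a * E U U' y v - c * x))"
      unfolding par by blast
    also have "\<dots> \<longleftrightarrow> (\<exists>u v. u\<^sup>2 = poly (P X) y \<and> v\<^sup>2 = poly (P U) y \<and>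
       (\<exists>w x. w\<^sup>2 = F X X' y u \<and> x\<^sup>2 = F U U' y v \<and> D y u v = w - x))"
    proof -
      have "(\<exists>w x. w\<^sup>2 = (E X X' y u)\<^sup>2 - 4 * of_real X' \<and> x\<^sup>2 = (E U U' y v)\<^sup>2 - 4 * of_real U' \<and>
         of_real X' + \<rho> - a * E X X' y u - c * w = of_real U' + \<rho> - a * E U U' y v - c * x) \<longleftrightarrow>
         (\<exists>w x. w\<^sup>2 = F X X' y u \<and> x\<^sup>2 = F U U' y v \<and> D y u v = w - x)" (is "?l = ?r") for u v
      proof
        assume ?l
        then obtain w x where wx: "w\<^sup>2 = (E X X' y u)\<^sup>2 - 4 * of_real X'" "x\<^sup>2 = (E U U' y v)\<^sup>2 - 4 * of_real U'"
         "of_real X' + \<rho> - a * E X X' y u - c * w = of_real U' + \<rho> - a * E U U' y v - c * x" by blast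
        have "(c * w)\<^sup>2 = F X X' y u" "(c * x)\<^sup>2 = F U U' y v"
          unfolding F_def power_mult_distrib wx by simp_all
        moreover have "D y u v = c * w - c * x" using wx(3) by (simp add: D_def algebra_simps)
        ultimately show ?r by blast
      next
        assume ?r
        then obtain w x where wx: "w\<^sup>2 = F X X' y u" "x\<^sup>2 = F U U' y v" "D y u v = w - x" by blast
        have "(w / c)\<^sup>2 = (E X X' y u)\<^sup>2 - 4 * of_real X'" "(x / c)\<^sup>2 = (E U U' y v)\<^sup>2 - 4 * of_real U'"
          unfolding power_divide wx using c by (simp_all add: F_def)
        moreover have "of_real X' + \<rho> - a * E X X' y u - c * (w / c) = of_real U' + \<rho> - a * E U U' y v - c * (x / c)"
          using wx(3) c by (simp add: D_def algebra_simps)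
        ultimately show ?l by blast
      qed
      then show ?thesis by simp
    qed
    also have "\<dots> \<longleftrightarrow> (\<exists>u v. u\<^sup>2 = poly (P X) y \<and> v\<^sup>2 = poly (P U) y \<and> h y u v = 0)"
      unfolding difference_of_roots h_def by simp
    finally show ?thesis .
  qed
  have degP: "degree (P X) \<le> 2" for X
    unfolding P_def p_def by (intro degree_diff_le) (auto intro: order_trans[OF degree_mult_le])
  note mult = biquadratic_mult[OF _ _ degP degP]
  have bE: "biquadratic 1 (P X) (P U) (\<lambda>y u v. E X X' y u)"
    using biquadratic_linear[of "[:of_real (X' - X):] + smult \<alpha> (p X)" 1 "P X" "P U" \<gamma> 0]
    by (simp add: E_def p_def algebra_simps)
  have bE': "biquadratic 1 (P X) (P U) (\<lambda>y u v. E U U' y v)"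
    using biquadratic_linear[of "[:of_real (U' - U):] + smult \<alpha> (p U)" 1 "P X" "P U" 0 \<gamma>]
    by (simp add: E_def p_def algebra_simps)
  have bD: "biquadratic 1 (P X) (P U) D"
    using biquadratic_linear[of "[:of_real (X' - U') - a * (of_real (X' - X) - of_real (U' - U)):] - smult (a * \<alpha>) (p X - p U)" 1 "P X" "P U" "- a * \<gamma>" "a * \<gamma>"]
    by (simp add: E_def p_def D_def algebra_simps)
  have const: "biquadratic 0 (P X) (P U) (\<lambda>y u v. k)" for k
    using biquadratic_linear[of "[:k:]" 0 "P X" "P U" 0 0] by simp
  have bF: "biquadratic 10 (P X) (P U) (\<lambda>y u v. F X X' y u)"
    using mult[OF const[of "c\<^sup>2"] biquadratic_diff[OF mult[OF bE bE] const[of "4 * of_real X'"]]]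
    by (simp add: F_def power2_eq_square)
  have bF': "biquadratic 10 (P X) (P U) (\<lambda>y u v. F U U' y v)"
    using mult[OF const[of "c\<^sup>2"] biquadratic_diff[OF mult[OF bE' bE'] const[of "4 * of_real U'"]]]
    by (simp add: F_def power2_eq_square)
  have "biquadratic 10 (P X) (P U) (\<lambda>y u v. D y u v * D y u v - F X X' y u - F U U' y v)"
    using biquadratic_diff[OF biquadratic_diff[OF mult[OF bD bD] bF] bF'] by simp
  \<comment> \<open>The square has bound 10 + 10 + 4 = 24 and the triple product (0 + 10 + 4) + 10 +
    4 = 28. Elimination then yields 4 * 28 + 10 = 122.\<close>
  from biquadratic_diff[OF mult[OF this this] mult[OF mult[OF const[of 4] bF] bF']]
  have "biquadratic 28 (P X) (P U) h"
    by (simp add: h_def power2_eq_square)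
  from eliminate_square_roots[OF this degP degP] obtain G where "degree G \<le> 4 * 28 + 10"
    "\<And>y. poly G y = 0 \<longleftrightarrow> (\<exists>u v. u\<^sup>2 = poly (P X) y \<and> v\<^sup>2 = poly (P U) y \<and> h y u v = 0)"
    by blast
  then show ?thesis using ex by (intro that[of G]) auto
qed

lemma common_curve_finite:
  assumes b: "Re b \<noteq> 0" "Im b \<noteq> 0" and ne: "X \<noteq> X'" "U \<noteq> U'" "(X, X') \<noteq> (U, U')"
  shows "finite {y. \<exists>y'. curve b X X' y y' \<and> curve b U U' y y'}"
    and "card {y. \<exists>y'. curve b X X' y y' \<and> curve b U U' y y'} \<le> 122"
proof -
  have "b \<noteq> 0" "b \<noteq> cnj b" using b by (auto simp: complex_eq_iff)
  then obtain G where G: "degree G \<le> 122"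
    "\<forall>y. poly G y = 0 \<longleftrightarrow> (\<exists>y'. curve b X X' y y' \<and> curve b U U' y y')"
    by (rule common_curve_poly[of b X X' U U'])
  have "G \<noteq> 0" using curves_not_everywhere[OF b ne] G(2) by fastforce
  then show "finite {y. \<exists>y'. curve b X X' y y' \<and> curve b U U' y y'}"
    "card {y. \<exists>y'. curve b X X' y y' \<and> curve b U U' y y'} \<le> 122"
    using poly_roots_finite[of G] card_poly_roots_bound[of G] G by auto
qed

text \<open>Actual points of the plane are the points of the complexified locus with
  \<open>t = cnj s\<close> and \<open>t' = cnj s'\<close>.\<close>

lemma curve_of_points:
  assumes "cmod (q - 1) = cmod (q' - 1)"
  shows "curve b ((cmod q)\<^sup>2) ((cmod q')\<^sup>2) (of_real ((cmod (q - b))\<^sup>2)) (of_real ((cmod (q' - b))\<^sup>2))"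
proof -
  have sq: "of_real ((cmod (z - a))\<^sup>2) = (z - a) * (cnj z - cnj a)" for z a
    using complex_norm_square[of "z - a"] by simp
  have 1: "q * cnj q = of_real ((cmod q)\<^sup>2)" "q' * cnj q' = of_real ((cmod q')\<^sup>2)"
    by (simp_all only: complex_norm_square)
  have 2: "(q - 1) * (cnj q - 1) = (q' - 1) * (cnj q' - 1)"
    using sq[of q 1] sq[of q' 1] assms by simp
  show ?thesis unfolding curve_def
    by (rule exI[of _ q], rule exI[of _ "cnj q"], rule exI[of _ q'], rule exI[of _ "cnj q'"])
       (intro conjI 1 2 sq)
qed

section \<open>Points in a sector\<close>

text \<open>The imaginary part is, up to sign, the cross product of \<open>q - u\<close> and
  \<open>v - u\<close>. Points on the line count as \<open>True\<close>, so the two truth values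
  partition the plane.\<close>

definition side :: "complex \<Rightarrow> complex \<Rightarrow> complex \<Rightarrow> bool" where
  "side u v q \<longleftrightarrow> Im ((q - u) * cnj (v - u)) \<ge> 0"

lemma same_side_unique:
  \<comment> \<open>The two distances determine a point up to reflection in the line through
    \<open>u\<close> and \<open>v\<close>: they fix \<open>Re w\<close> and the absolute value of
    \<open>Im w\<close>, and the side fixes its sign.\<close>
  assumes uv: "u \<noteq> v" and d: "cmod (q - u) = cmod (q' - u)" "cmod (q - v) = cmod (q' - v)"
    and s: "side u v q = side u v q'"
  shows "q = q'"
proof -
  define w w' where "w = (q - u) * cnj (v - u)" and "w' = (q' - u) * cnj (v - u)"
  have sq: "(cmod (z - v))\<^sup>2 = (cmod (z - u))\<^sup>2 + (cmod (v - u))\<^sup>2 - 2 * Re ((z - u) * cnj (v - u))" for z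
    by (simp only: cmod_power2) (simp add: power2_eq_square algebra_simps)
  have re: "Re w = Re w'" using sq[of q] sq[of q'] d by (simp add: w_def w'_def)
  have "cmod w = cmod w'" by (simp add: w_def w'_def norm_mult d flip: complex_cnj_diff)
  then have "(Re w)\<^sup>2 + (Im w)\<^sup>2 = (Re w')\<^sup>2 + (Im w')\<^sup>2" by (metis cmod_power2)
  then have "(Im w)\<^sup>2 = (Im w')\<^sup>2" using re by simp
  then have "Im w = Im w' \<or> Im w = - Im w'" by (rule power2_eq_iff[THEN iffD1])
  moreover have "Im w \<ge> 0 \<longleftrightarrow> Im w' \<ge> 0" using s by (simp add: side_def w_def w'_def)
  ultimately have "Im w = Im w'" by linarith
  then have "w = w'" using re by (simp add: complex_eq_iff)
  then show ?thesis using uv by (simp add: w_def w'_def)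
qed

lemma sign_mult_sum:
  fixes p p' q q' :: real
  assumes "0 \<le> p \<longleftrightarrow> 0 \<le> p'" "0 \<le> q \<longleftrightarrow> 0 \<le> q'"
  shows "0 \<le> (if 0 \<le> p \<longleftrightarrow> 0 \<le> q then 1 else - 1) * ((p + p') * (q + q'))"
proof -
  have "0 \<le> p + p' \<and> 0 \<le> p \<or> p + p' \<le> 0 \<and> \<not> 0 \<le> p" "0 \<le> q + q' \<and> 0 \<le> q \<or> q + q' \<le> 0 \<and> \<not> 0 \<le> q"
    using assms by auto
  then show ?thesis by (auto simp: mult_nonneg_nonneg mult_nonpos_nonpos mult_nonneg_nonpos mult_nonpos_nonneg)
qed

text \<open>
  On a circle about the origin \<open>w - w'\<close> and \<open>w + w'\<close> are orthogonal, so each factor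
  \<open>Re ((w - w') * cnj z)\<close> is a multiple, with a coefficient independent of \<open>z\<close>, of
  \<open>Im ((w + w') * cnj z)\<close>, whose sign is known.
\<close>
lemma sector_monotone:
  fixes w w' e f :: complex
  assumes nrm: "cmod w = cmod w'" and ef: "Im (e * cnj f) \<noteq> 0"
    and s: "Im (w * cnj e) \<ge> 0 \<longleftrightarrow> Im (w' * cnj e) \<ge> 0" "Im (w * cnj f) \<ge> 0 \<longleftrightarrow> Im (w' * cnj f) \<ge> 0"
  shows "0 \<le> (if Im (w * cnj e) \<ge> 0 \<longleftrightarrow> Im (w * cnj f) \<ge> 0 then 1 else - 1) *
     (Re ((w - w') * cnj e) * Re ((w - w') * cnj f))" (is "0 \<le> ?\<eta> * ?p")
proof -
  define d v where "d = w - w'" and "v = w + w'"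
  have orth: "Re d * Re v + Im d * Im v = 0"
  proof -
    have "(Re w)\<^sup>2 + (Im w)\<^sup>2 = (Re w')\<^sup>2 + (Im w')\<^sup>2" using nrm by (metis cmod_power2)
    then show ?thesis by (simp add: d_def v_def power2_eq_square algebra_simps)
  qed
  have 1: "Im v * Re (d * cnj z) = Re d * Im (v * cnj z)" for z
  proof -
    have "Im v * Re (d * cnj z) - Re d * Im (v * cnj z) = Im z * (Re d * Re v + Im d * Im v)"
      by (simp add: algebra_simps)
    then show ?thesis by (simp only: orth)
  qed
  have 2: "Re v * Re (d * cnj z) = - (Im d * Im (v * cnj z))" for z
  proof -
    have "Re v * Re (d * cnj z) + Im d * Im (v * cnj z) = Re z * (Re d * Re v + Im d * Im v)"
      by (simp add: algebra_simps)
    then show ?thesis by (simp only: orth)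
  qed
  have "((Re v)\<^sup>2 + (Im v)\<^sup>2) * ?p = (Re v * Re (d * cnj e)) * (Re v * Re (d * cnj f))
      + (Im v * Re (d * cnj e)) * (Im v * Re (d * cnj f))"
    unfolding d_def[symmetric] by (simp only: power2_eq_square) (simp only: algebra_simps)
  also have "\<dots> = ((Re d)\<^sup>2 + (Im d)\<^sup>2) * (Im (v * cnj e) * Im (v * cnj f))"
    unfolding 1 2 by (simp only: power2_eq_square) (simp only: algebra_simps minus_mult_minus)
  finally have id: "(cmod v)\<^sup>2 * ?p = (cmod d)\<^sup>2 * (Im (v * cnj e) * Im (v * cnj f))"
    by (simp only: cmod_power2)
  have vz: "Im (v * cnj z) = Im (w * cnj z) + Im (w' * cnj z)" for z
    by (simp add: v_def algebra_simps)
  show ?thesis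
  proof (cases "v = 0")
    \<comment> \<open>Here \<open>w' = - w\<close>, so agreement of the side tests puts
      \<open>w\<close> on both lines. These are transversal, hence \<open>w = 0\<close>.\<close>
    case True
    have "Im (w * cnj z) + Im (w' * cnj z) = 0" for z
      unfolding vz[symmetric] True by simp
    from this[of e] this[of f] have "Im (w * cnj e) = 0" "Im (w * cnj f) = 0"
      using s by smt+
    moreover have "Im (e * cnj f) * Re w = Re e * Im (w * cnj f) - Re f * Im (w * cnj e)"
      "Im (e * cnj f) * Im w = Im e * Im (w * cnj f) - Im f * Im (w * cnj e)"
      by (simp_all add: algebra_simps)
    ultimately have "Im (e * cnj f) * Re w = 0" "Im (e * cnj f) * Im w = 0"
      by simp_all
    then have "w = 0" using ef by (simp add: complex_eq_iff)
    then show ?thesis using True by (simp add: v_def)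
  next
    case False
    have "0 \<le> ?\<eta> * (Im (v * cnj e) * Im (v * cnj f))"
      unfolding vz using s by (rule sign_mult_sum)
    then have "0 \<le> (cmod v)\<^sup>2 * (?\<eta> * ?p)"
      using id by (metis mult.left_commute mult_nonneg_nonneg zero_le_power2)
    then show ?thesis using False by (simp add: zero_le_mult_iff)
  qed
qed

section \<open>Counting pairs of points within one sector\<close>

text \<open>Cauchy-Schwarz for the fibre sizes of \<open>Z\<close>; the pairs are ordered and
  include the diagonal.\<close>

lemma card_le_collisions:
  assumes "finite Q"
  shows "(card Q)\<^sup>2 \<le> card (Z ` Q) * card {(q, q'). q \<in> Q \<and> q' \<in> Q \<and> Z q = Z q'}"
proof -
  have W: "{(q, q'). q \<in> Q \<and> q' \<in> Q \<and> Z q = Z q'} =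
      (\<Union>z\<in>Z ` Q. {q \<in> Q. Z q = z} \<times> {q \<in> Q. Z q = z})" by auto
  have "card {(q, q'). q \<in> Q \<and> q' \<in> Q \<and> Z q = Z q'} = (\<Sum>z\<in>Z ` Q. (card {q \<in> Q. Z q = z})\<^sup>2)"
    unfolding W using assms by (subst card_UN_disjoint) (auto simp: card_cartesian_product power2_eq_square)
  moreover have "card Q = (\<Sum>z\<in>Z ` Q. card {q \<in> Q. Z q = z})"
    using assms by (subst card_UN_disjoint[symmetric]) (auto intro!: arg_cong[of _ _ card])
  moreover have "real ((\<Sum>z\<in>Z ` Q. card {q \<in> Q. Z q = z})\<^sup>2) \<le>
      real (card (Z ` Q) * (\<Sum>z\<in>Z ` Q. (card {q \<in> Q. Z q = z})\<^sup>2))"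
    using sum_squared_le_sum_of_squares[of "\<lambda>z. real (card {q \<in> Q. Z q = z})" "Z ` Q"]
    by (simp add: mult.commute)
  ultimately show ?thesis by (simp only: of_nat_le_iff)
qed

lemma sector_bound:
  fixes Q :: "complex set" and b :: complex
  assumes b: "Re b \<noteq> 0" "Im b \<noteq> 0" and fin: "finite Q"
    and sides: "\<And>q q'. q \<in> Q \<Longrightarrow> q' \<in> Q \<Longrightarrow>
      side 0 1 q = side 0 1 q' \<and> side b 0 q = side b 0 q' \<and> side b 1 q = side b 1 q'"
    and m: "card ((\<lambda>q. (cmod q)\<^sup>2) ` Q) \<le> m" "card ((\<lambda>q. (cmod (q - b))\<^sup>2) ` Q) \<le> m"
      "card ((\<lambda>q. (cmod (q - 1))\<^sup>2) ` Q) \<le> m" and k: "k > 0"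
  shows "card Q \<le> m\<^sup>2"
    and "(card Q)\<^sup>2 \<le> m * (card Q + (2 * (m div k + 1) * m\<^sup>2 + 122 * ((m div k + 1)\<^sup>2 * k^4)))"
proof -
  define X Y Z where "X = (\<lambda>q. (cmod q)\<^sup>2)" and "Y = (\<lambda>q. (cmod (q - b))\<^sup>2)" and "Z = (\<lambda>q. (cmod (q - 1))\<^sup>2)"
  note m = m[folded X_def Y_def Z_def]
  have b01: "b \<noteq> 0" "b \<noteq> 1" using b by auto
  have XZ: "q = q'" if "q \<in> Q" "q' \<in> Q" "X q = X q'" "Z q = Z q'" for q q'
    using same_side_unique[of 0 1 q q'] sides[OF that(1,2)] that(3,4) by (simp add: X_def Z_def)
  have XY: "q = q'" if "q \<in> Q" "q' \<in> Q" "X q = X q'" "Y q = Y q'" for q q'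
    using same_side_unique[of b 0 q q'] sides[OF that(1,2)] that(3,4) b01 by (simp add: X_def Y_def)
  have YZ: "q = q'" if "q \<in> Q" "q' \<in> Q" "Y q = Y q'" "Z q = Z q'" for q q'
    using same_side_unique[of b 1 q q'] sides[OF that(1,2)] that(3,4) b01 by (simp add: Y_def Z_def)
  \<comment> \<open>Within the sector, moving on a circle about \<open>b\<close> changes
    \<open>X\<close> and \<open>Z\<close> always in the same direction or always in opposite
    directions; \<open>\<eta>\<close> records which.\<close>
  obtain \<eta> :: real where \<eta>: "\<eta> = 1 \<or> \<eta> = - 1"
    and mono: "\<And>q q'. q \<in> Q \<Longrightarrow> q' \<in> Q \<Longrightarrow> Y q = Y q' \<Longrightarrow> 0 \<le> \<eta> * ((X q - X q') * (Z q - Z q'))"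
  proof (cases "Q = {}")
    case False
    then obtain q0 where q0: "q0 \<in> Q" by auto
    define \<eta> :: real where "\<eta> = (if side b 0 q0 \<longleftrightarrow> side b 1 q0 then 1 else - 1)"
    show ?thesis
    proof (rule that[of \<eta>])
      fix q q' assume q: "q \<in> Q" "q' \<in> Q" "Y q = Y q'"
      have ef: "Im ((0 - b) * cnj (1 - b)) \<noteq> 0" using b by (simp add: algebra_simps)
      have "\<eta> = (if side b 0 q \<longleftrightarrow> side b 1 q then 1 else - 1)"
        using sides[OF q(1) q0] by (simp add: \<eta>_def)
      then have pos: "0 \<le> \<eta> * (Re ((q - b - (q' - b)) * cnj (0 - b)) * Re ((q - b - (q' - b)) * cnj (1 - b)))"
        using sector_monotone[of "q - b" "q' - b" "0 - b" "1 - b"] ef q(3) sides[OF q(1,2)]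
        unfolding side_def Y_def by simp
      have sq: "(cmod (q - u))\<^sup>2 - (cmod (q' - u))\<^sup>2 =
          (cmod (q - b))\<^sup>2 - (cmod (q' - b))\<^sup>2 - 2 * Re ((q - b - (q' - b)) * cnj (u - b))" for u
        by (simp only: cmod_power2) (simp add: power2_eq_square algebra_simps)
      have X: "X q - X q' = - 2 * Re ((q - b - (q' - b)) * cnj (0 - b))"
        and Z: "Z q - Z q' = - 2 * Re ((q - b - (q' - b)) * cnj (1 - b))"
        using sq[of 0] sq[of 1] q(3) unfolding X_def Y_def Z_def by simp_all
      have "\<eta> * ((- 2 * x) * (- 2 * z)) = 4 * (\<eta> * (x * z))" for x z by simp
      then show "0 \<le> \<eta> * ((X q - X q') * (Z q - Z q'))"
        unfolding X Z using pos by (metis mult_nonneg_nonneg zero_le_numeral)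
    qed (auto simp: \<eta>_def)
  qed auto
  have finX: "finite (X ` Q)" using fin by auto
  have "card Q \<le> card (X ` Q \<times> Y ` Q)"
    by (rule card_inj_on_le[of "\<lambda>q. (X q, Y q)"]) (use XY fin in \<open>auto simp: inj_on_def\<close>)
  also have "\<dots> \<le> m\<^sup>2" using m by (simp add: card_cartesian_product power2_eq_square mult_le_mono)
  finally show "card Q \<le> m\<^sup>2" .

  \<comment> \<open>Ranks turn the at most \<open>m\<close> values of \<open>X\<close> into
    coordinates below \<open>m\<close> while preserving their order.\<close>
  define rk where "rk = (\<lambda>x. card {a \<in> X ` Q. a < x})"
  have rk_mono: "rk x \<le> rk y" if "x \<le> y" for x y
    unfolding rk_def using that finX by (intro card_mono) auto
  have rk_less: "rk x < rk y" if "x \<in> X ` Q" "x < y" for x y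
    unfolding rk_def using that finX by (intro psubset_card_mono) auto
  have rk_inj: "x = y" if "x \<in> X ` Q" "y \<in> X ` Q" "rk x = rk y" for x y
    using rk_less that by (metis less_irrefl linorder_neqE)
  have rk_m: "rk x < m" if "x \<in> X ` Q" for x
  proof -
    have "rk x < card (X ` Q)" unfolding rk_def using that finX by (intro psubset_card_mono) auto
    then show ?thesis using m(1) by linarith
  qed
  define W where "W = {(q, q'). q \<in> Q \<and> q' \<in> Q \<and> Z q = Z q'}"
  define \<phi> where "\<phi> = (\<lambda>(q, q'). ((rk (X q), rk (X q')), (Y q, Y q')))"
  define I where "I = \<phi> ` {(q, q') \<in> W. q \<noteq> q'}"
  define L where "L = Y ` Q \<times> Y ` Q"
  have inI: "\<exists>q q'. q \<in> Q \<and> q' \<in> Q \<and> Z q = Z q' \<and> q \<noteq> q' \<and> x = rk (X q) \<and> x' = rk (X q') \<and> g = (Y q, Y q')"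
    if "((x, x'), g) \<in> I" for x x' g
    using that unfolding I_def W_def \<phi>_def by auto
  have bound: "card I \<le> 2 * (m div k + 1) * card L + 122 * ((m div k + 1)\<^sup>2 * k^4)"
  proof (rule grid_incidence_bound[OF _ _ k])
    show "I \<subseteq> ({..<m} \<times> {..<m}) \<times> L"
      using rk_m by (auto simp: I_def W_def \<phi>_def L_def)
    show "finite L" using fin by (simp add: L_def)
  next
    fix g x x' y y' assume xy: "((x, x'), g) \<in> I" "((y, y'), g) \<in> I" "x < y"
    obtain q q' where q: "q \<in> Q" "q' \<in> Q" "Z q = Z q'" "x = rk (X q)" "x' = rk (X q')" "g = (Y q, Y q')"
      using inI[OF xy(1)] by blast
    obtain p p' where p: "p \<in> Q" "p' \<in> Q" "Z p = Z p'" "y = rk (X p)" "y' = rk (X p')" "g = (Y p, Y p')"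
      using inI[OF xy(2)] by blast
    have lt: "X q < X p" using xy(3) rk_mono[of "X p" "X q"] q p by (meson linorder_not_le)
    then have "q \<noteq> p" by auto
    then have Zne: "Z q \<noteq> Z p" using YZ[of q p] q p by auto
    \<comment> \<open>Both pairs have the same index \<open>g\<close>, so each coordinate moves on a
      circle about \<open>b\<close>, and the increment of \<open>Z\<close> is common to both.
      Multiplying the two inequalities removes \<open>\<eta>\<close> and shows that the increments
      of \<open>X\<close> cannot have opposite signs.\<close>
    have 1: "0 \<le> \<eta> * ((X q - X p) * (Z q - Z p))" using mono[of q p] q p by simp
    have 2: "0 \<le> \<eta> * ((X q' - X p') * (Z q - Z p))" using mono[of q' p'] q p by simp
    have "X q' \<le> X p'"
    proof (rule ccontr)
      assume "\<not> X q' \<le> X p'"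
      then have "(X q - X p) * (X q' - X p') < 0" using lt by (simp add: mult_neg_pos)
      moreover have "(Z q - Z p)\<^sup>2 > 0" using Zne by simp
      ultimately have "(Z q - Z p)\<^sup>2 * ((X q - X p) * (X q' - X p')) < 0" by (simp only: mult_pos_neg)
      moreover have "0 \<le> (\<eta> * ((X q - X p) * (Z q - Z p))) * (\<eta> * ((X q' - X p') * (Z q - Z p)))"
        using 1 2 by (rule mult_nonneg_nonneg)
      then have "0 \<le> (Z q - Z p)\<^sup>2 * ((X q - X p) * (X q' - X p'))"
        using \<eta> by (auto simp: power2_eq_square mult_ac)
      ultimately show False by linarith
    qed
    then show "x' \<le> y'" using rk_mono q p by simp
  next
    fix u v :: "nat \<times> nat" assume uv: "u \<noteq> v"
    let ?S = "{g. (u, g) \<in> I \<and> (v, g) \<in> I}"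
    show "card ?S \<le> 122"
    proof (cases "?S = {}")
      case False
      then obtain g0 where g0: "(u, g0) \<in> I" "(v, g0) \<in> I" by blast
      obtain x x' y y' where uv': "u = (x, x')" "v = (y, y')" by fastforce
      obtain q q' where q: "q \<in> Q" "q' \<in> Q" "Z q = Z q'" "q \<noteq> q'" "x = rk (X q)" "x' = rk (X q')"
        using inI[OF g0(1)[unfolded uv']] by blast
      obtain p p' where p: "p \<in> Q" "p' \<in> Q" "Z p = Z p'" "p \<noteq> p'" "y = rk (X p)" "y' = rk (X p')"
        using inI[OF g0(2)[unfolded uv']] by blast
      have rep: "\<exists>r r' s s'. r \<in> Q \<and> r' \<in> Q \<and> s \<in> Q \<and> s' \<in> Q \<and> Z r = Z r' \<and> Z s = Z s' \<and> X r = X q \<and> X r' = X q' \<and>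
          X s = X p \<and> X s' = X p' \<and> g = (Y r, Y r') \<and> g = (Y s, Y s')" if g: "g \<in> ?S" for g
      proof -
        from g have g1: "((x, x'), g) \<in> I" and g2: "((y, y'), g) \<in> I" unfolding uv' by auto
        obtain r r' where r: "r \<in> Q" "r' \<in> Q" "Z r = Z r'" "x = rk (X r)" "x' = rk (X r')" "g = (Y r, Y r')"
          using inI[OF g1] by blast
        obtain s s' where s: "s \<in> Q" "s' \<in> Q" "Z s = Z s'" "y = rk (X s)" "y' = rk (X s')" "g = (Y s, Y s')"
          using inI[OF g2] by blast
        have "X r = X q" "X r' = X q'" "X s = X p" "X s' = X p'"
          using rk_inj r s p q by (metis imageI)+
        then show ?thesis using r s by metis
      qed
      let ?C = "{y. \<exists>y'. curve b (X q) (X q') y y' \<and> curve b (X p) (X p') y y'}"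
      have ne: "X q \<noteq> X q'" "X p \<noteq> X p'" "(X q, X q') \<noteq> (X p, X p')"
        using XZ[of q q'] XZ[of p p'] q p uv uv' by auto
      \<comment> \<open>The first entry of \<open>g\<close> already determines it: with the fixed
        \<open>X\<close>-value it determines \<open>r\<close>, and then \<open>Z r' = Z r\<close>
        with the fixed \<open>X r'\<close> determines \<open>r'\<close>.\<close>
      have "card ?S \<le> card ?C"
      proof (rule card_inj_on_le)
        show "inj_on (\<lambda>g. of_real (fst g) :: complex) ?S"
        proof (rule inj_onI)
          fix g h assume gh: "g \<in> ?S" "h \<in> ?S" "complex_of_real (fst g) = of_real (fst h)"
          obtain r r' where r: "r \<in> Q" "r' \<in> Q" "Z r = Z r'" "X r = X q" "X r' = X q'" "g = (Y r, Y r')"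
            using rep[OF gh(1)] by blast
          obtain s s' where s: "s \<in> Q" "s' \<in> Q" "Z s = Z s'" "X s = X q" "X s' = X q'" "h = (Y s, Y s')"
            using rep[OF gh(2)] by blast
          have "r = s" using XY[of r s] r s gh(3) by simp
          then have "r' = s'" using XZ[of r' s'] r s by simp
          then show "g = h" using r s \<open>r = s\<close> by simp
        qed
        show "(\<lambda>g. of_real (fst g) :: complex) ` ?S \<subseteq> ?C"
        proof clarsimp
          fix Y1 Y2 assume "(u, Y1, Y2) \<in> I" "(v, Y1, Y2) \<in> I"
          then have "(Y1, Y2) \<in> ?S" by simp
          from rep[OF this] obtain r r' s s' where rs: "Z r = Z r'" "Z s = Z s'" "X r = X q" "X r' = X q'"
            "X s = X p" "X s' = X p'" "(Y1, Y2) = (Y r, Y r')" "(Y1, Y2) = (Y s, Y s')" by blast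
          have "curve b (X r) (X r') (of_real (Y r)) (of_real (Y r'))"
            "curve b (X s) (X s') (of_real (Y s)) (of_real (Y s'))"
            using curve_of_points[of r r' b] curve_of_points[of s s' b] rs(1,2) by (simp_all add: X_def Y_def Z_def)
          then show "\<exists>y'. curve b (X q) (X q') (of_real Y1) y' \<and> curve b (X p) (X p') (of_real Y1) y'"
            using rs by (metis Pair_inject)
        qed
        show "finite ?C" by (rule common_curve_finite(1)[OF b ne])
      qed
      also have "\<dots> \<le> 122" by (rule common_curve_finite(2)[OF b ne])
      finally show ?thesis .
    next
      case True
      show ?thesis unfolding True by simp
    qed
  qed
  have finW: "finite W" by (rule finite_subset[of _ "Q \<times> Q"]) (use fin in \<open>auto simp: W_def\<close>)
  have "inj_on \<phi> {(q, q') \<in> W. q \<noteq> q'}"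
  proof (rule inj_onI, clarify)
    fix q q' p p' assume "(q, q') \<in> W" "(p, p') \<in> W" "\<phi> (q, q') = \<phi> (p, p')"
    then have "q \<in> Q" "q' \<in> Q" "p \<in> Q" "p' \<in> Q" "X q = X p" "X q' = X p'" "Y q = Y p" "Y q' = Y p'"
      using rk_inj by (auto simp: W_def \<phi>_def)
    then show "q = p \<and> q' = p'" using XY by blast
  qed
  then have cI: "card I = card {(q, q') \<in> W. q \<noteq> q'}" unfolding I_def by (rule card_image)
  \<comment> \<open>Diagonal pairs were left out of \<open>I\<close> because the multiplicity bound
    requires \<open>X q\<close> and \<open>X q'\<close> to differ; they cost only
    \<open>card Q\<close>.\<close>
  have "W \<subseteq> (\<lambda>q. (q, q)) ` Q \<union> {(q, q') \<in> W. q \<noteq> q'}" by (auto simp: W_def)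
  then have "card W \<le> card ((\<lambda>q. (q, q)) ` Q \<union> {(q, q') \<in> W. q \<noteq> q'})"
    using fin finW by (intro card_mono) (auto intro: finite_subset)
  also have "\<dots> \<le> card ((\<lambda>q. (q, q)) ` Q) + card {(q, q') \<in> W. q \<noteq> q'}" by (rule card_Un_le)
  also have "\<dots> \<le> card Q + card I" using card_image_le[OF fin, of "\<lambda>q. (q, q)"] cI by simp
  finally have cW: "card W \<le> card Q + card I" .
  have "card L \<le> m\<^sup>2" using m(2) by (simp add: L_def card_cartesian_product power2_eq_square mult_le_mono)
  then have "2 * (m div k + 1) * card L \<le> 2 * (m div k + 1) * m\<^sup>2" by (rule mult_le_mono2)
  then have "card W \<le> card Q + (2 * (m div k + 1) * m\<^sup>2 + 122 * ((m div k + 1)\<^sup>2 * k^4))"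
    using cW bound by linarith
  then have "card (Z ` Q) * card W \<le> m * (card Q + (2 * (m div k + 1) * m\<^sup>2 + 122 * ((m div k + 1)\<^sup>2 * k^4)))"
    using m(3) by (rule mult_le_mono[rotated])
  then show "(card Q)\<^sup>2 \<le> m * (card Q + (2 * (m div k + 1) * m\<^sup>2 + 122 * ((m div k + 1)\<^sup>2 * k^4)))"
    using card_le_collisions[OF fin, of Z] unfolding W_def by linarith
qed

section \<open>Choice of the cell size and union over the sectors\<close>

text \<open>With \<open>t\<close> the cube root of \<open>m\<close>, cells of width about
  \<open>t\<close> balance the two incidence terms at order \<open>t^8\<close>; the factor
  \<open>m\<close> raises this to \<open>t^11\<close>.\<close>

lemma exponent_arithmetic:
  fixes n m :: nat
  assumes "m > 0" and le: "n \<le> m\<^sup>2"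
    and bound: "\<And>k. k > 0 \<Longrightarrow> n\<^sup>2 \<le> m * (n + (2 * (m div k + 1) * m\<^sup>2 + 122 * ((m div k + 1)\<^sup>2 * k^4)))"
  shows "real n \<le> 89 * real m powr (11/6)"
proof -
  define t where "t = real m powr (1/3)"
  have t1: "t \<ge> 1" using \<open>m > 0\<close> by (simp add: t_def ge_one_powr_ge_zero)
  have t3: "real m = t^3" using \<open>m > 0\<close> by (simp add: t_def powr_power)
  have t11: "(real m powr (11/6))\<^sup>2 = t^11" using \<open>m > 0\<close> by (simp add: t_def powr_power)
  define k where "k = nat \<lceil>t\<rceil>"
  have kt: "real k \<ge> t" unfolding k_def by (rule real_nat_ceiling_ge)
  have k0: "k > 0" using kt t1 by (cases k) auto
  have k2: "real k \<le> 2 * t" using t1 unfolding k_def by linarith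
  have "real (m div k) \<le> real m / real k" by (rule of_nat_div_le_of_nat)
  also have "\<dots> \<le> t^3 / t" unfolding t3 using kt t1 by (intro divide_left_mono) auto
  also have "\<dots> = t^2" using t1 by (simp add: power2_eq_square power3_eq_cube)
  finally have r: "real (m div k + 1) \<le> 2 * t^2" using one_le_power[OF t1, of 2] by simp
  have n6: "real n \<le> t^6"
  proof -
    have "real n \<le> (real m)\<^sup>2" using le by (simp flip: of_nat_power)
    then show ?thesis by (simp add: t3 flip: power_mult)
  qed
  have "real (n\<^sup>2) \<le> real (m * (n + (2 * (m div k + 1) * m\<^sup>2 + 122 * ((m div k + 1)\<^sup>2 * k^4))))"
    using bound[OF k0] by (simp only: of_nat_le_iff)
  also have "\<dots> = t^3 * (real n + (2 * real (m div k + 1) * (t^3)\<^sup>2 + 122 * ((real (m div k + 1))\<^sup>2 * (real k)^4)))"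
    by (simp add: t3 algebra_simps)
  also have "\<dots> \<le> t^3 * (t^6 + (2 * (2 * t^2) * (t^3)\<^sup>2 + 122 * ((2 * t^2)\<^sup>2 * (2 * t)^4)))"
    using n6 r k2 t1 by (intro mult_left_mono add_mono mult_mono power_mono mult_right_mono) auto
  also have "\<dots> = t^9 + 7812 * t^11"
    by (simp add: algebra_simps flip: power_add power_mult)
  \<comment> \<open>Absorbing \<open>t^9\<close> gives 7813, rounded up to the square of 89.\<close>
  also have "\<dots> \<le> 7921 * t^11"
    using power_increasing[of 9 11 t] zero_le_power[of t 11] t1 by linarith
  also have "\<dots> = (89 * real m powr (11/6))\<^sup>2"
    by (simp add: power_mult_distrib t11)
  finally have "(real n)\<^sup>2 \<le> (89 * real m powr (11/6))\<^sup>2" by (simp only: of_nat_power)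
  then show ?thesis by (rule power2_le_imp_le) simp
qed

text \<open>The three side tests have eight outcomes, and 712 is 8 times 89.\<close>

lemma card_le_distances_complex:
  fixes P :: "complex set" and b :: complex
  assumes b: "Re b \<noteq> 0" "Im b \<noteq> 0" and fin: "finite P" and m0: "m > 0"
    and m: "card ((\<lambda>q. (cmod q)\<^sup>2) ` P) \<le> m" "card ((\<lambda>q. (cmod (q - b))\<^sup>2) ` P) \<le> m"
      "card ((\<lambda>q. (cmod (q - 1))\<^sup>2) ` P) \<le> m"
  shows "real (card P) \<le> 712 * real m powr (11/6)"
proof -
  define \<sigma> where "\<sigma> = (\<lambda>q. (side 0 1 q, side b 0 q, side b 1 q))"
  define Q where "Q = (\<lambda>s. {q \<in> P. \<sigma> q = s})"
  have Q: "real (card (Q s)) \<le> 89 * real m powr (11/6)" for s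
  proof -
    have "card (f ` Q s) \<le> m" if "card (f ` P) \<le> m" for f :: "complex \<Rightarrow> real"
      using that fin by (auto intro: order_trans[OF card_mono] simp: Q_def)
    note mQ = this[OF m(1)] this[OF m(2)] this[OF m(3)]
    have fQ: "finite (Q s)" using fin by (simp add: Q_def)
    have sides: "side 0 1 q = side 0 1 q' \<and> side b 0 q = side b 0 q' \<and> side b 1 q = side b 1 q'"
      if "q \<in> Q s" "q' \<in> Q s" for q q' using that unfolding Q_def \<sigma>_def by auto
    show ?thesis
      by (rule exponent_arithmetic[OF m0])
         (rule sector_bound[OF b fQ sides mQ zero_less_one] sector_bound(2)[OF b fQ sides mQ]; assumption)+
  qed
  have "P = (\<Union>s. Q s)" by (auto simp: Q_def)
  then have "card P \<le> (\<Sum>s\<in>UNIV. card (Q s))" using card_UN_le[of UNIV Q] by simp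
  then have "real (card P) \<le> (\<Sum>s\<in>UNIV. real (card (Q s)))" by (simp flip: of_nat_sum)
  also have "\<dots> \<le> (\<Sum>s\<in>(UNIV :: (bool \<times> bool \<times> bool) set). 89 * real m powr (11/6))"
    by (intro sum_mono Q)
  also have "\<dots> = 712 * real m powr (11/6)" by (simp add: card_prod)
  finally show ?thesis .
qed

section \<open>Transfer to the Euclidean plane\<close>

definition to_complex :: "real^2 \<Rightarrow> complex" where
  "to_complex v = Complex (v $ 1) (v $ 2)"

lemma to_complex_diff: "to_complex (u - v) = to_complex u - to_complex v"
  by (simp add: to_complex_def complex_eq_iff)

lemma cmod_to_complex: "cmod (to_complex v) = norm v"
  by (simp add: to_complex_def cmod_def norm_vec_def L2_set_def sum_2)

lemma to_complex_eq_iff: "to_complex u = to_complex v \<longleftrightarrow> u = v"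
  by (auto simp: to_complex_def vec_eq_iff forall_2)

text \<open>A similarity sends \<open>p1\<close>, \<open>p2\<close>, \<open>p3\<close> to
  \<open>0\<close>, \<open>b\<close>, \<open>1\<close>. It rescales all distances by one factor, so
  their number is controlled. Noncollinearity makes \<open>Im b\<close> nonzero, and the absence of
  a right angle at \<open>p1\<close> makes \<open>Re b\<close> nonzero.\<close>

lemma card_le_distances:
  fixes p1 p2 p3 :: "real^2" and P :: "(real^2) set"
  assumes nc: "\<not> collinear {p1, p2, p3}" and nr: "(p2 - p1) \<bullet> (p3 - p1) \<noteq> 0" and fin: "finite P"
  shows "real (card P) \<le> 712 * real (card {dist p q | p q. p \<in> {p1, p2, p3} \<and> q \<in> P}) powr (11/6)"
proof (cases "P = {}")
  case False
  define D where "D = {dist p q | p q. p \<in> {p1, p2, p3} \<and> q \<in> P}"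
  have D: "D = (\<lambda>(p, q). dist p q) ` ({p1, p2, p3} \<times> P)" by (auto simp: D_def)
  have finD: "finite D" unfolding D using fin by auto
  have m0: "card D > 0" using finD False unfolding D by (auto simp: card_gt_0_iff)
  define z b where "z = to_complex (p3 - p1)" and "b = to_complex (p2 - p1) / z"
  have "p3 \<noteq> p1" using nr by auto
  then have z: "z \<noteq> 0" by (auto simp: z_def to_complex_diff to_complex_eq_iff)
  have bz: "b * z = to_complex (p2 - p1)" using z by (simp add: b_def)
  have Im: "Im b \<noteq> 0"
  proof
    assume "Im b = 0"
    then have "to_complex (p2 - p1) = to_complex (Re b *\<^sub>R (p3 - p1))"
      unfolding bz[symmetric] z_def by (simp add: to_complex_def complex_eq_iff)
    then have "p2 - p1 = Re b *\<^sub>R (p3 - p1)" by (simp only: to_complex_eq_iff)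
    then have "collinear {0, p3 - p1, p2 - p1}" unfolding collinear_lemma by auto
    then have "collinear {p3, p1, p2}" by (subst collinear_3) (simp_all add: NO_MATCH_def)
    then show False using nc by (simp add: insert_commute)
  qed
  have Re: "Re b \<noteq> 0"
  proof
    assume R: "Re b = 0"
    have "(p2 - p1) \<bullet> (p3 - p1) = Re (to_complex (p2 - p1) * cnj z)"
      by (simp add: z_def to_complex_def inner_vec_def sum_2 algebra_simps)
    also have "\<dots> = Re b * (cmod z)\<^sup>2"
      unfolding bz[symmetric] cmod_power2 by (simp add: power2_eq_square algebra_simps)
    finally show False using nr R by simp
  qed
  define f where "f = (\<lambda>q. to_complex (q - p1) / z)"
  have inj: "inj f" using z by (auto simp: inj_def f_def to_complex_diff to_complex_eq_iff)
  have fd: "cmod (f q - f p) = dist p q / cmod z" for p q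
    using z by (simp add: f_def to_complex_diff dist_norm norm_minus_commute norm_divide
        flip: diff_divide_distrib cmod_to_complex)
  have card: "card ((\<lambda>q. (cmod (q - f p))\<^sup>2) ` f ` P) \<le> card D" if "p \<in> {p1, p2, p3}" for p
  proof -
    have "(\<lambda>q. (cmod (q - f p))\<^sup>2) ` f ` P = (\<lambda>d. (d / cmod z)\<^sup>2) ` dist p ` P"
      by (simp add: image_image fd)
    also have "card \<dots> \<le> card (dist p ` P)" using fin by (intro card_image_le) auto
    also have "\<dots> \<le> card D" using finD that by (intro card_mono) (auto simp: D_def)
    finally show ?thesis .
  qed
  have "f p1 = 0" "f p2 = b" "f p3 = 1" using z by (auto simp: f_def b_def z_def to_complex_diff)
  then have "real (card (f ` P)) \<le> 712 * real (card D) powr (11/6)"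
    using card[of p1] card[of p2] card[of p3] fin
    by (intro card_le_distances_complex[OF Re Im _ m0]) auto
  then show ?thesis using inj by (simp add: card_image inj_on_subset D_def)
qed simp

theorem theorem1:
  "\<exists>c::real. c > 0 \<and>
     (\<forall>(p1::real^2) p2 p3 (P::(real^2) set).
        \<not> collinear {p1, p2, p3} \<longrightarrow> finite P \<longrightarrow>
        p1 \<notin> P \<longrightarrow> p2 \<notin> P \<longrightarrow> p3 \<notin> P \<longrightarrow>
        real (card {dist p q | p q. p \<in> {p1, p2, p3} \<and> q \<in> P})
          \<ge> c * real (card P) powr (6/11))"
proof (intro exI conjI allI impI)
  show "(1 / 712) powr (6/11) > (0::real)" by simp
  fix p1 p2 p3 :: "real^2" and P :: "(real^2) set"
  assume nc: "\<not> collinear {p1, p2, p3}" and fin: "finite P"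
  define m where "m = card {dist p q | p q. p \<in> {p1, p2, p3} \<and> q \<in> P}"
  have "p1 \<noteq> p2" using nc by auto
  \<comment> \<open>The two inner products sum to the squared distance of \<open>p1\<close> and
    \<open>p2\<close>, so they cannot both vanish. If the angle at \<open>p1\<close> is right, the
    roles of \<open>p1\<close> and \<open>p2\<close> are exchanged.\<close>
  then have "(p2 - p1) \<bullet> (p3 - p1) \<noteq> 0 \<or> (p1 - p2) \<bullet> (p3 - p2) \<noteq> 0"
    by (smt (verit) inner_diff_left inner_diff_right inner_commute inner_eq_zero_iff right_minus_eq)
  then have "real (card P) \<le> 712 * real m powr (11/6)"
  proof
    assume "(p2 - p1) \<bullet> (p3 - p1) \<noteq> 0"
    then show ?thesis unfolding m_def by (rule card_le_distances[OF nc _ fin])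
  next
    assume nr: "(p1 - p2) \<bullet> (p3 - p2) \<noteq> 0"
    have "\<not> collinear {p2, p1, p3}" using nc by (simp add: insert_commute)
    from card_le_distances[OF this nr fin] show ?thesis by (simp add: m_def insert_commute)
  qed
  then have "(1 / 712 * real (card P)) powr (6/11) \<le> (real m powr (11/6)) powr (6/11)"
    by (intro powr_mono2) auto
  also have "\<dots> = real m" by (simp add: powr_powr)
  finally show "(1 / 712) powr (6/11) * real (card P) powr (6/11) \<le>
      real (card {dist p q | p q. p \<in> {p1, p2, p3} \<and> q \<in> P})"
    unfolding m_def[symmetric] by (simp add: powr_divide)
qed

end
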